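(* Let $\mathbb{K}$ be a field with $\operatorname{char}(\mathbb{K})\neq 2$. For a positive integer $n$, let $V=\mathbb{K}^n$ with standard basis $e_1,\dots,e_n$ and let $$\operatorname{perm}_n=\sum_{\sigma\in\mathfrak{S}_n}e_{\sigma(1)}\otimes e_{\sigma(2)}\otimes\cdots\otimes e_{\sigma(n)}\in V^{\otimes n}$$ be the permanent tensor. Then $\mathbf{R}(\operatorname{perm}_4)=\underline{\mathbf{R}}(\operatorname{perm}_4)=8$ and $\underline{\mathbf{R}}(\operatorname{perm}_5)\geq 15$.
   Context: $\mathfrak{S}_n$ is the symmetric group on $n$ letters. For finite-dimensional $\mathbb{K}$-vector spaces $V_1,\dots,V_d$ and $T\in V_1\otimes\cdots\otimes V_d$, the tensor rank $\mathbf{R}(T)$ is the minimal $k$ such that $T=\sum_{i=1}^k v_{i,1}\otimes\cdots\otimes v_{i,d}$ with $v_{i,j}\in V_j$. The border rank $\underline{\mathbf{R}}(T)$ is the minimal $k$ such that $T$ lies in the Zariski closure, in $V_1\otimes\cdots\otimes V_d$, of the set of tensors of tensor rank $\le k$. *)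

theory Defs
  imports
    "HOL-Combinatorics.Permutations"
    "Jordan_Normal_Form.Matrix"
begin

text \<open>
  The tensor product of the coordinate spaces \<open>carrier_vec n1, \<dots>, carrier_vec nd\<close> is represented by coordinate arrays.
  The format \<open>ns = [n1, \<dots>, nd]\<close> lists the dimensions (\<open>d \<ge> 1\<close> is intended), a multi-index is a
  list \<open>I\<close> of length \<open>d\<close> with \<open>I ! j < ns ! j\<close>, and a tensor is a function that vanishes outside
  the multi-indices. As for vectors and matrices, indices start at 0.
\<close>

type_synonym 'k tensor = "nat list \<Rightarrow> 'k"

definition multi_indices :: "nat list \<Rightarrow> nat list set" where
  "multi_indices ns = {I. list_all2 (<) I ns}"

definition tensor_space :: "nat list \<Rightarrow> 'k::field tensor set" where
  "tensor_space ns = {T. \<forall>I. I \<notin> multi_indices ns \<longrightarrow> T I = 0}"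

text \<open>The decomposable tensor \<open>v1 \<otimes> \<dots> \<otimes> vd\<close>, whose format is given by the dimensions of the \<open>vj\<close>.\<close>

definition pure_tensor :: "'k::field vec list \<Rightarrow> 'k tensor" where
  "pure_tensor vs = (\<lambda>I. if I \<in> multi_indices (map dim_vec vs)
     then \<Prod>j<length vs. vs ! j $ (I ! j) else 0)"

definition tensor_rank :: "nat list \<Rightarrow> 'k::field tensor \<Rightarrow> nat" where
  "tensor_rank ns T = (LEAST k. \<exists>v :: nat \<Rightarrow> 'k vec list.
     (\<forall>i<k. map dim_vec (v i) = ns) \<and> T = (\<lambda>I. \<Sum>i<k. pure_tensor (v i) I))"

text \<open>
  The polynomial functions in the coordinates \<open>x i\<close>, \<open>i \<in> A\<close>. For \<open>A\<close> the set of multi-indices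
  of a format, these are the polynomial functions on the space of tensors of that format.
\<close>

inductive_set poly_funs :: "'i set \<Rightarrow> (('i \<Rightarrow> 'k::field) \<Rightarrow> 'k) set" for A :: "'i set" where
  const: "(\<lambda>x. c) \<in> poly_funs A"
| coord: "i \<in> A \<Longrightarrow> (\<lambda>x. x i) \<in> poly_funs A"
| add: "p \<in> poly_funs A \<Longrightarrow> q \<in> poly_funs A \<Longrightarrow> (\<lambda>x. p x + q x) \<in> poly_funs A"
| mult: "p \<in> poly_funs A \<Longrightarrow> q \<in> poly_funs A \<Longrightarrow> (\<lambda>x. p x * q x) \<in> poly_funs A"

definition zariski_closed :: "nat list \<Rightarrow> 'k::field tensor set \<Rightarrow> bool" where
  "zariski_closed ns Z \<longleftrightarrow> (\<exists>P \<subseteq> poly_funs (multi_indices ns).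
     Z = {T \<in> tensor_space ns. \<forall>p\<in>P. p T = 0})"

text \<open>\<open>zariski_closed ns hull S\<close> is the intersection of all Zariski closed sets containing \<open>S\<close>.\<close>

definition border_rank :: "nat list \<Rightarrow> 'k::field tensor \<Rightarrow> nat" where
  "border_rank ns T =
     (LEAST k. T \<in> zariski_closed ns hull {S \<in> tensor_space ns. tensor_rank ns S \<le> k})"

definition perm_tensor :: "nat \<Rightarrow> 'k::field tensor" where
  "perm_tensor n = (\<lambda>I. \<Sum>\<sigma> | \<sigma> permutes {..<n}.
     pure_tensor (map (\<lambda>j. unit_vec n (\<sigma> j)) [0..<n]) I)"

lemma perm_tensor_in_tensor_space: "perm_tensor n \<in> tensor_space (replicate n n)"
  by (auto simp: tensor_space_def perm_tensor_def pure_tensor_def comp_def map_replicate_const)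

end

theory Submission
  imports Defs "Jordan_Normal_Form.Determinant"
begin

text \<open>
  The lower bounds come from flattenings in which several tensor factors act by exterior
  multiplication or contraction (recursive Koszul flattenings). A vector of \<open>K^N\<close> acts
  from the vectors to the 2-forms, or back by contraction, with rank at most \<open>N - 1\<close>. Hence a tensor
  \<open>v1 \<otimes> \<dots> \<otimes> vd\<close> is sent to a matrix whose rank is at most the product \<open>s\<close> of these numbers, and a tensor
  of border rank at most \<open>k\<close> to a matrix all of whose minors of size exceeding \<open>k * s\<close> vanish. For the
  permanent of order 4, two factors \<open>K^4\<close> give \<open>s = 9\<close>. For order 5 one first projects three factors to
  \<open>K^3\<close>, \<open>K^4\<close> and \<open>K^4\<close>, which gives \<open>s = 18\<close>. In both cases an integral echelon form whose
  pivots are signed powers of 2 bounds the rank from below in every characteristic other than 2.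
  The upper bound for order 4 is Glynn's formula.
\<close>

section \<open>Matrices of bounded rank\<close>

text \<open>A factorization through \<open>K^s\<close> stands for rank at most \<open>s\<close>, so
  that rows and columns may be labelled by arbitrary types without carrying dimensions
  along.\<close>

definition low_rank :: "nat \<Rightarrow> ('a \<Rightarrow> 'b \<Rightarrow> 'k::field) \<Rightarrow> bool" where
  "low_rank s M \<longleftrightarrow> (\<exists>u w. \<forall>p q. M p q = (\<Sum>t<s. u p t * w t q))"

text \<open>Inner indices from any finite set of size \<open>s\<close> are allowed, such as pairs
  for sums and products of matrices.\<close>

lemma low_rankI:
  assumes "finite J" "card J = s" "\<And>p q. M p q = (\<Sum>t\<in>J. u p t * w t q)"
  shows "low_rank s M"
proof -
  obtain h where h: "bij_betw h {..<s} J"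
    using ex_bij_betw_nat_finite[OF assms(1)] assms(2) by (auto simp: atLeast0LessThan)
  have "M p q = (\<Sum>t<s. u p (h t) * w (h t) q)" for p q
    unfolding assms(3) by (rule sum.reindex_bij_betw[OF h, symmetric])
  then show ?thesis unfolding low_rank_def
    by (intro exI[of _ "\<lambda>p t. u p (h t)"] exI[of _ "\<lambda>t. w (h t)"]) blast
qed

lemma low_rank_zero: "low_rank s (\<lambda>p q. 0)"
  unfolding low_rank_def by (intro exI[of _ "\<lambda>_ _. 0"]) simp

lemma low_rank_transpose: "low_rank s M \<Longrightarrow> low_rank s (\<lambda>q p. M p q)"
proof -
  assume "low_rank s M"
  then obtain u w where "\<And>p q. M p q = (\<Sum>t<s. u p t * w t q)"
    by (auto simp: low_rank_def)
  then show ?thesis unfolding low_rank_def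
    by (intro exI[of _ "\<lambda>q t. w t q"] exI[of _ "\<lambda>t p. u p t"]) (simp add: mult.commute)
qed

text \<open>Masking and relabelling rows touches only the left factor of the factorization, and
  doing so for columns only the right one.\<close>

lemma low_rank_reindex:
  assumes "low_rank s M"
  shows "low_rank s (\<lambda>p q. if P p \<and> Q q then M (f p) (g q) else 0)"
proof -
  obtain u w where uw: "\<And>p q. M p q = (\<Sum>t<s. u p t * w t q)"
    using assms by (auto simp: low_rank_def)
  show ?thesis unfolding low_rank_def uw
    by (intro exI[of _ "\<lambda>p t. if P p then u (f p) t else 0"]
          exI[of _ "\<lambda>t q. if Q q then w t (g q) else 0"]) auto
qed

text \<open>Subadditivity of rank: the factorizations are put side by side, with pairs of a summand
  and an inner index as the new inner index.\<close>

lemma low_rank_sum: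
  assumes "\<And>i. i < k \<Longrightarrow> low_rank s (M i)"
  shows "low_rank (k * s) (\<lambda>p q. \<Sum>i<k. M i p q)"
proof -
  have "\<forall>i. \<exists>u w. i < k \<longrightarrow> (\<forall>p q. M i p q = (\<Sum>t<s. u p t * w t q))"
    using assms unfolding low_rank_def by blast
  then obtain u w where uw: "\<And>i p q. i < k \<Longrightarrow> M i p q = (\<Sum>t<s. u i p t * w i t q)"
    by metis
  show ?thesis
  proof (rule low_rankI)
    have "(\<Sum>i<k. M i p q)
      = (\<Sum>(i, t)\<in>{..<k} \<times> {..<s}. u i p t * w i t q)" for p q
      by (simp add: uw sum.cartesian_product)
    then show "(\<Sum>i<k. M i p q) = (\<Sum>x\<in>{..<k} \<times> {..<s}.
        (case x of (i, t) \<Rightarrow> u i p t) * (case x of (i, t) \<Rightarrow> w i t q))" for p q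
      by (simp add: case_prod_unfold)
  qed simp_all
qed

text \<open>Rank bounds multiply under the Kronecker product, because the two factorizations can be
  multiplied entrywise.\<close>

lemma low_rank_mult:
  fixes M :: "'a \<Rightarrow> 'b \<Rightarrow> 'e::field"
  assumes "low_rank s M" "low_rank s' M'"
  shows "low_rank (s * s') (\<lambda>(p, p') (q, q'). M p q * M' p' q')"
proof -
  obtain u w where uw: "\<And>p q. M p q = (\<Sum>t<s. u p t * w t q)"
    using assms(1) by (auto simp: low_rank_def)
  obtain u' w' where uw': "\<And>p q. M' p q = (\<Sum>t<s'. u' p t * w' t q)"
    using assms(2) by (auto simp: low_rank_def)
  have *: "(\<Sum>t<s. f t) * (\<Sum>t<s'. f' t)
      = (\<Sum>z\<in>{..<s} \<times> {..<s'}. f (fst z) * f' (snd z))" for f f' :: "nat \<Rightarrow> 'e"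
    by (simp add: sum_product sum.cartesian_product case_prod_unfold)
  show ?thesis
    by (rule low_rankI[of "{..<s} \<times> {..<s'}" _ _
          "\<lambda>x z. u (fst x) (fst z) * u' (snd x) (snd z)"
          "\<lambda>z y. w (fst z) (fst y) * w' (snd z) (snd y)"])
       (auto simp: uw uw' * case_prod_unfold intro!: sum.cong)
qed

text \<open>Combining rows acts on the left factor alone and selecting columns on the right one.
  This permits row reduction inside a flattening.\<close>

lemma low_rank_combination:
  assumes "low_rank s M"
  shows "low_rank s (\<lambda>i j. \<Sum>x\<leftarrow>X i. c x * M (r x) (C j))"
proof -
  obtain u w where uw: "\<And>p q. M p q = (\<Sum>t<s. u p t * w t q)"
    using assms by (auto simp: low_rank_def)
  have "(\<Sum>x\<leftarrow>xs. c x * M (r x) (C j)) = (\<Sum>t<s. (\<Sum>x\<leftarrow>xs. c x * u (r x) t) * w t (C j))" for xs j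
    by (induction xs) (simp_all add: uw sum_distrib_left sum.distrib algebra_simps)
  then show ?thesis unfolding low_rank_def
    by (intro exI[of _ "\<lambda>i t. \<Sum>x\<leftarrow>X i. c x * u (r x) t"] exI[of _ "\<lambda>t j. w t (C j)"]) blast
qed

text \<open>The factorization is padded with zeros to a product of square matrices of size
  \<open>D\<close>, whose left factor then has a zero column.\<close>

lemma det_low_rank:
  fixes M :: "nat \<Rightarrow> nat \<Rightarrow> 'k::field"
  assumes "low_rank s M" "s < D"
  shows "det (mat D D (\<lambda>(i, j). M i j)) = 0"
proof -
  obtain u w where uw: "\<And>p q. M p q = (\<Sum>t<s. u p t * w t q)"
    using assms by (auto simp: low_rank_def)
  define A where "A = mat D D (\<lambda>(i, t). if t < s then u i t else 0)"
  define B where "B = mat D D (\<lambda>(t, j). w t j)"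
  have AB: "A \<in> carrier_mat D D" "B \<in> carrier_mat D D"
    by (simp_all add: A_def B_def)
  have "mat D D (\<lambda>(i, j). M i j) = A * B"
  proof (rule eq_matI)
    fix i j assume "i < dim_row (A * B)" "j < dim_col (A * B)"
    then have ij: "i < D" "j < D" using AB by auto
    have "M i j = (\<Sum>t<D. (if t < s then u i t else 0) * w t j)"
      unfolding uw using assms(2) by (intro sum.mono_neutral_cong_left) auto
    then show "mat D D (\<lambda>(i, j). M i j) $$ (i, j) = (A * B) $$ (i, j)"
      using ij by (simp add: A_def B_def scalar_prod_def atLeast0LessThan)
  qed (use AB in auto)
  moreover have "det A = 0"
  proof -
    \<comment> \<open>Column \<open>s\<close> of \<open>A\<close> is a padding column; it exists
      because \<open>s < D\<close>.\<close>
    have "A *\<^sub>v unit_vec D s = 0\<^sub>v D"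
      using assms(2) by (intro eq_vecI) (simp_all add: A_def)
    moreover have "unit_vec D s \<noteq> (0\<^sub>v D :: 'k vec)"
      using assms(2) by auto
    ultimately show ?thesis
      using det_0_iff_vec_prod_zero_field[OF AB(1)] unit_vec_carrier by metis
  qed
  ultimately show ?thesis using det_mult[OF AB] by simp
qed

text \<open>
  Since \<open>x \<and> x = 0\<close>, the rows of the matrix of \<open>e a \<mapsto> x \<and> e a\<close>, weighted by the \<open>x a\<close>, add up to zero, so
  one of them is a combination of the others.
\<close>

lemma low_rank_alternating:
  fixes x :: "nat \<Rightarrow> 'k::field"
  shows "low_rank (N - 1) (\<lambda>a q. if a < N then \<Sum>b<N. x b * (g b a q - g a b q) else 0)"
proof (cases "\<exists>i<N. x i \<noteq> 0")
  case False
  then have "(\<lambda>a q. if a < N then \<Sum>b<N. x b * (g b a q - g a b q) else 0) = (\<lambda>a q. 0)"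
    by (intro ext) simp
  then show ?thesis by (simp only: low_rank_zero)
next
  case True
  then obtain i where i: "i < N" "x i \<noteq> 0" by auto
  define M where "M a q = (\<Sum>b<N. x b * (g b a q - g a b q))" for a q
  \<comment> \<open>Row \<open>a\<close> is written in terms of the rows other than
    \<open>i\<close>: trivially for \<open>a \<noteq> i\<close>, and for \<open>a = i\<close> by
    solving the linear relation \<open>rel\<close> for row \<open>i\<close>.\<close>
  define u where "u a t = (if a < N then if a = i then - x t / x i else if a = t then 1 else 0 else 0)"
    for a t
  \<comment> \<open>The weight \<open>x a * x b\<close> is symmetric in \<open>a\<close> and
    \<open>b\<close>, so the two halves of the alternating difference cancel in the double
    sum.\<close>
  have swap: "(\<Sum>a<N. \<Sum>b<N. x a * (x b * g b a q)) = (\<Sum>a<N. \<Sum>b<N. x a * (x b * g a b q))" for q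
    by (subst sum.swap) (simp add: mult.left_commute)
  have "(\<Sum>a<N. x a * M a q) = 0" for q
    by (simp add: M_def sum_distrib_left algebra_simps sum_subtractf swap)
  then have rel: "x i * M i q + (\<Sum>a\<in>{..<N} - {i}. x a * M a q) = 0" for q
    using i(1) by (simp add: sum.remove[of "{..<N}" i])
  show ?thesis
  proof (rule low_rankI)
    show "card ({..<N} - {i}) = N - 1" using i(1) by simp
  next
    fix a q
    have "M i q = - (\<Sum>t\<in>{..<N} - {i}. x t * M t q) / x i"
      using rel[of q] i(2) by (simp add: field_simps add_eq_0_iff)
    then have "M i q = (\<Sum>t\<in>{..<N} - {i}. u i t * M t q)"
      using i(1) by (simp add: u_def sum_divide_distrib sum_negf)
    moreover have "M a q = (\<Sum>t\<in>{..<N} - {i}. u a t * M t q)" if "a < N" "a \<noteq> i"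
    proof -
      have "(\<Sum>t\<in>{..<N} - {i}. u a t * M t q) = (\<Sum>t\<in>{..<N} - {i}. if t = a then M t q else 0)"
        using that by (intro sum.cong) (auto simp: u_def)
      then show ?thesis using that by simp
    qed
    ultimately show "(if a < N then \<Sum>b<N. x b * (g b a q - g a b q) else 0)
        = (\<Sum>t\<in>{..<N} - {i}. u a t * M t q)"
      unfolding M_def[symmetric] by (cases "a = i") (auto simp: u_def[of a] i(1))
  qed simp
qed

section \<open>Border rank bounds from flattenings\<close>

lemma multi_indices_Nil: "multi_indices [] = {[]}"
  by (auto simp: multi_indices_def)

lemma multi_indices_Cons:
  "multi_indices (n # ns) = (\<lambda>(i, I). i # I) ` ({..<n} \<times> multi_indices ns)"
  by (auto simp: multi_indices_def list_all2_Cons2)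

lemma finite_multi_indices: "finite (multi_indices ns)"
  by (induction ns) (auto simp: multi_indices_Nil multi_indices_Cons)

lemma sum_multi_indices_Cons:
  "(\<Sum>I\<in>multi_indices (n # ns). h I) = (\<Sum>i<n. \<Sum>I\<in>multi_indices ns. h (i # I))"
  unfolding multi_indices_Cons
  by (subst sum.reindex) (auto simp: inj_on_def sum.cartesian_product case_prod_unfold)

lemma pure_tensor_Nil: "pure_tensor [] [] = 1"
  by (simp add: pure_tensor_def multi_indices_Nil)

lemma pure_tensor_Cons:
  "pure_tensor (v # vs) (i # I) = (if i < dim_vec v then v $ i * pure_tensor vs I else 0)"
proof -
  have "(\<Prod>j<length (v # vs). (v # vs) ! j $ ((i # I) ! j))
      = v $ i * (\<Prod>j<length vs. vs ! j $ (I ! j))"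
    by (simp only: list.size add_0_right One_nat_def add_Suc_right prod.lessThan_Suc_shift) simp
  then show ?thesis
    by (auto simp: pure_tensor_def multi_indices_Cons)
qed

lemma pure_tensor_outside: "I \<notin> multi_indices (map dim_vec vs) \<Longrightarrow> pure_tensor vs I = 0"
  by (simp add: pure_tensor_def)

text \<open>These tensors form the standard basis of the tensor space.\<close>

lemma pure_tensor_unit:
  assumes "I \<in> multi_indices ns" "J \<in> multi_indices ns"
  shows "pure_tensor (map2 unit_vec ns J) I = (if I = J then 1 else 0)"
  using assms
proof (induction ns arbitrary: I J)
  case Nil
  then show ?case by (simp add: multi_indices_Nil pure_tensor_Nil)
next
  case (Cons n ns)
  then show ?case by (auto simp: multi_indices_Cons pure_tensor_Cons split: if_splits)
qed

text \<open>Guarantees that the minimum defining \<open>tensor_rank\<close> is attained. The tensor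
  is expanded in the standard basis, each coefficient being absorbed into the first vector of its
  basis tensor.\<close>

lemma ex_pure_decomposition:
  fixes S :: "'k::field tensor"
  assumes "S \<in> tensor_space ns" "ns \<noteq> []"
  shows "\<exists>k. \<exists>v :: nat \<Rightarrow> 'k vec list.
     (\<forall>i<k. map dim_vec (v i) = ns) \<and> S = (\<lambda>I. \<Sum>i<k. pure_tensor (v i) I)"
proof -
  obtain n ns' where ns: "ns = n # ns'" using assms(2) by (cases ns) auto
  define V where "V J = (S J \<cdot>\<^sub>v unit_vec n (hd J)) # map2 unit_vec ns' (tl J)" for J
  have dim: "map dim_vec (V J) = ns" if "J \<in> multi_indices ns" for J
    using that unfolding ns V_def multi_indices_def
    by (auto simp: list_all2_Cons2 list_all2_lengthD intro!: nth_equalityI)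
  have V: "pure_tensor (V J) I = (if I = J then S I else 0)"
    if IJ: "I \<in> multi_indices ns" "J \<in> multi_indices ns" for I J
    using IJ unfolding ns V_def
    by (auto simp: multi_indices_Cons pure_tensor_Cons pure_tensor_unit split: if_splits)
  obtain h where h: "bij_betw h {..<card (multi_indices ns)} (multi_indices ns)"
    using ex_bij_betw_nat_finite[OF finite_multi_indices] by (auto simp: atLeast0LessThan)
  have "S I = (\<Sum>i<card (multi_indices ns). pure_tensor (V (h i)) I)" for I
  proof -
    have "(\<Sum>i<card (multi_indices ns). pure_tensor (V (h i)) I)
        = (\<Sum>J\<in>multi_indices ns. pure_tensor (V J) I)"
      by (rule sum.reindex_bij_betw[OF h])
    also have "\<dots> = S I"
    proof (cases "I \<in> multi_indices ns")
      case True
      then show ?thesis by (simp add: V finite_multi_indices cong: sum.cong)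
    next
      case False
      then have "S I = 0" using assms(1) by (simp add: tensor_space_def)
      moreover have "pure_tensor (V J) I = 0" if "J \<in> multi_indices ns" for J
        using False dim[OF that] by (simp add: pure_tensor_outside)
      ultimately show ?thesis by simp
    qed
    finally show ?thesis by simp
  qed
  moreover have "\<forall>i<card (multi_indices ns). map dim_vec (V (h i)) = ns"
    using bij_betwE[OF h] dim by auto
  ultimately show ?thesis
    by (intro exI[of _ "card (multi_indices ns)"] exI[of _ "\<lambda>i. V (h i)"] conjI ext)
qed

lemma tensor_rank_decomposition:
  fixes S :: "'k::field tensor"
  assumes "S \<in> tensor_space ns" "ns \<noteq> []"
  obtains v :: "nat \<Rightarrow> 'k vec list" where
    "\<And>i. i < tensor_rank ns S \<Longrightarrow> map dim_vec (v i) = ns"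
    "S = (\<lambda>I. \<Sum>i<tensor_rank ns S. pure_tensor (v i) I)"
proof -
  have "\<exists>v :: nat \<Rightarrow> 'k vec list. (\<forall>i<tensor_rank ns S. map dim_vec (v i) = ns)
      \<and> S = (\<lambda>I. \<Sum>i<tensor_rank ns S. pure_tensor (v i) I)"
    unfolding tensor_rank_def by (rule LeastI_ex[OF ex_pure_decomposition[OF assms]])
  then show thesis using that by metis
qed

section \<open>Border rank and vanishing minors\<close>

lemma border_rank_le_tensor_rank:
  assumes "T \<in> tensor_space ns"
  shows "border_rank ns T \<le> tensor_rank ns T"
  unfolding border_rank_def by (rule Least_le, rule hull_inc) (use assms in simp)

text \<open>The minimum defining \<open>border_rank\<close> is attained, since the tensor rank is a
  candidate.\<close>

lemma in_hull_border_rank: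
  assumes "T \<in> tensor_space ns"
  shows "T \<in> zariski_closed ns hull {S \<in> tensor_space ns. tensor_rank ns S \<le> border_rank ns T}"
  unfolding border_rank_def
  by (rule LeastI[of _ "tensor_rank ns T"], rule hull_inc) (use assms in simp)

lemma poly_funs_sum:
  assumes "\<And>i. i \<in> J \<Longrightarrow> f i \<in> poly_funs A"
  shows "(\<lambda>x. \<Sum>i\<in>J. f i x) \<in> poly_funs A"
proof (cases "finite J")
  case True
  then show ?thesis using assms
    by (induction J) (auto intro: poly_funs.const poly_funs.add)
qed (simp add: poly_funs.const)

lemma poly_funs_prod:
  assumes "\<And>i. i \<in> J \<Longrightarrow> f i \<in> poly_funs A"
  shows "(\<lambda>x. \<Prod>i\<in>J. f i x) \<in> poly_funs A"
proof (cases "finite J")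
  case True
  then show ?thesis using assms
    by (induction J) (auto intro: poly_funs.const poly_funs.mult)
qed (simp add: poly_funs.const)

text \<open>The Leibniz formula is polynomial in the entries.\<close>

lemma poly_funs_det:
  assumes "\<And>i j. i < D \<Longrightarrow> j < D \<Longrightarrow> (\<lambda>x. M x i j) \<in> poly_funs A"
  shows "(\<lambda>x. det (mat D D (\<lambda>(i, j). M x i j))) \<in> poly_funs A"
proof -
  have "det (mat D D (\<lambda>(i, j). M x i j))
      = (\<Sum>p | p permutes {0..<D}. signof p * (\<Prod>i\<in>{0..<D}. M x i (p i)))" for x
    by (subst det_def'[of _ D]) (auto intro!: sum.cong prod.cong simp: permutes_in_image)
  moreover have "(\<lambda>x. \<Sum>p | p permutes {0..<D}. signof p * (\<Prod>i\<in>{0..<D}. M x i (p i)))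
      \<in> poly_funs A"
    using assms
    by (intro poly_funs_sum poly_funs.mult poly_funs.const poly_funs_prod)
       (auto simp: permutes_in_image)
  ultimately show ?thesis by simp
qed

text \<open>The general matrix of linear forms in the coordinates of a tensor; rows and columns need
  not come from a splitting of the tensor factors.\<close>

definition flattening ::
    "nat list \<Rightarrow> ('a \<Rightarrow> 'b \<Rightarrow> nat list \<Rightarrow> 'k::field) \<Rightarrow> 'k tensor \<Rightarrow> 'a \<Rightarrow> 'b \<Rightarrow> 'k" where
  "flattening ns cf S p q = (\<Sum>I\<in>multi_indices ns. cf p q I * S I)"

text \<open>On a sum of at most \<open>k\<close> pure tensors the flattening has rank at most
  \<open>k * s < D\<close>, so its minor of size \<open>D\<close> vanishes. The zero set of this
  minor is Zariski closed and would contain \<open>T\<close> if the border rank were at most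
  \<open>k\<close>.\<close>

theorem border_rank_greater:
  fixes T :: "'k::field tensor"
  assumes pure: "\<And>vs. map dim_vec vs = ns \<Longrightarrow> low_rank s (flattening ns cf (pure_tensor vs))"
    and T: "T \<in> tensor_space ns" and ns: "ns \<noteq> []"
    and less: "k * s < D" and det: "det (mat D D (\<lambda>(i, j). flattening ns cf T i j)) \<noteq> 0"
  shows "k < border_rank ns T"
proof (rule ccontr)
  assume "\<not> k < border_rank ns T"
  then have le: "border_rank ns T \<le> k" by simp
  define P where "P S = det (mat D D (\<lambda>(i, j). flattening ns cf S i j))" for S
  let ?R = "{S \<in> tensor_space ns. tensor_rank ns S \<le> border_rank ns T}"
  have "P \<in> poly_funs (multi_indices ns)"
    unfolding P_def flattening_def
    by (intro poly_funs_det poly_funs_sum poly_funs.mult poly_funs.const poly_funs.coord) simp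
  then have "zariski_closed ns {S \<in> tensor_space ns. P S = 0}"
    unfolding zariski_closed_def by (intro exI[of _ "{P}"]) auto
  moreover have "?R \<subseteq> {S \<in> tensor_space ns. P S = 0}"
  proof safe
    fix S :: "'k tensor" assume S: "S \<in> tensor_space ns" "tensor_rank ns S \<le> border_rank ns T"
    obtain v :: "nat \<Rightarrow> 'k vec list" where
      v: "\<And>i. i < tensor_rank ns S \<Longrightarrow> map dim_vec (v i) = ns" and
      Sv: "S = (\<lambda>I. \<Sum>i<tensor_rank ns S. pure_tensor (v i) I)"
      using tensor_rank_decomposition[OF S(1) ns] by blast
    have "flattening ns cf S p q
        = (\<Sum>i<tensor_rank ns S. flattening ns cf (pure_tensor (v i)) p q)" for p q
      unfolding flattening_def
      by (subst sum.swap, subst Sv) (simp add: sum_distrib_left)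
    then have "low_rank (tensor_rank ns S * s) (flattening ns cf S)"
      using low_rank_sum[of "tensor_rank ns S" s "\<lambda>i. flattening ns cf (pure_tensor (v i))"] pure v
      by presburger
    moreover have "tensor_rank ns S * s < D"
      using S(2) le less by (meson le_less_trans mult_le_mono1 order_trans)
    ultimately show "P S = 0" unfolding P_def by (rule det_low_rank)
  qed
  ultimately have "T \<in> {S \<in> tensor_space ns. P S = 0}"
    using in_hull_border_rank[OF T] hull_minimal by blast
  then show False using det by (simp add: P_def)
qed

section \<open>Koszul flattenings of the permanent\<close>

text \<open>
  A factor \<open>f\<close> turns the basis vector \<open>e i\<close> of one tensor factor into a sparse matrix, \<open>f i p\<close> being its
  row \<open>p\<close>. Rows and columns are labelled by basis elements of exterior powers, written as lists of
  indices. The factors \<open>wedge N m\<close> and \<open>contract N m\<close> first apply the linear map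
  \<open>e i \<mapsto> e (m ! i)\<close> into a space of dimension \<open>N\<close>.
\<close>

type_synonym factor = "nat \<Rightarrow> nat list \<Rightarrow> (nat list \<times> int) list"

text \<open>The tensor factor is put entirely on the row side: a vector becomes a matrix with a
  single column. \<open>column_index\<close> is the transposed choice.\<close>

fun row_index :: factor where
  "row_index i [a] = (if a = i then [([], 1)] else [])"
| "row_index i _ = []"

fun column_index :: factor where
  "column_index i [] = [([i], 1)]"
| "column_index i _ = []"

text \<open>The 2-form \<open>e b \<and> e a\<close>, normalized with its sign to an increasing
  pair.\<close>

definition wedge_basis :: "nat \<Rightarrow> nat \<Rightarrow> (nat list \<times> int) list" where
  "wedge_basis b a = (if b < a then [([b, a], 1)] else if a < b then [([a, b], - 1)] else [])"

fun wedge :: "nat \<Rightarrow> nat list \<Rightarrow> factor" where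
  "wedge N m i [a] = (if a < N then wedge_basis (m ! i) a else [])"
| "wedge N m i _ = []"

text \<open>The contraction of \<open>e b \<and> e c\<close> by the dual vector of
  \<open>e a\<close>. For \<open>a = b = c\<close> both entries are present and cancel.\<close>

definition contract_basis :: "nat \<Rightarrow> nat \<Rightarrow> nat \<Rightarrow> (nat list \<times> int) list" where
  "contract_basis a b c = (if a = b then [([c], 1)] else []) @ (if a = c then [([b], - 1)] else [])"

fun contract :: "nat \<Rightarrow> nat list \<Rightarrow> factor" where
  "contract N m i [b, c] = (if b < N \<and> c < N then contract_basis (m ! i) b c else [])"
| "contract N m i _ = []"

section \<open>Rank bounds for single factors\<close>

definition coef :: "('a \<times> int) list \<Rightarrow> 'a \<Rightarrow> int" where
  "coef L q = (\<Sum>(q', v)\<leftarrow>L. if q' = q then v else 0)"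

lemma coef_simps [simp]:
  "coef [] q = 0"
  "coef ((q', v) # L) q = (if q' = q then v else 0) + coef L q"
  "coef (L @ L') q = coef L q + coef L' q"
  by (simp_all add: coef_def)

text \<open>The bound concerns the matrix that the factor assigns to an arbitrary vector
  \<open>v\<close>. The type argument fixes the field, which \<open>n\<close>, \<open>f\<close> and
  \<open>s\<close> do not mention.\<close>

definition factor_low_rank :: "'k::field itself \<Rightarrow> nat \<Rightarrow> factor \<Rightarrow> nat \<Rightarrow> bool" where
  "factor_low_rank _ n f s \<longleftrightarrow>
     (\<forall>v :: nat \<Rightarrow> 'k. low_rank s (\<lambda>p q. \<Sum>i<n. of_int (coef (f i p) q) * v i))"

lemma factor_low_rank_row_index: "factor_low_rank TYPE('k::field) n row_index 1"
  unfolding factor_low_rank_def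
proof
  fix v :: "nat \<Rightarrow> 'k"
  have "(\<Sum>i<n. of_int (coef (row_index i p) q) * v i)
      = (\<Sum>i<n. if p = [i] then v i else 0) * (if q = [] then 1 else 0)" for p q
    unfolding sum_distrib_right
    by (intro sum.cong refl, cases "(0::nat, p)" rule: row_index.cases) auto
  then show "low_rank 1 (\<lambda>p q. \<Sum>i<n. of_int (coef (row_index i p) q) * v i)"
    by (intro low_rankI[of "{0::nat}" _ _ "\<lambda>p t. \<Sum>i<n. if p = [i] then v i else 0"
          "\<lambda>t q. if q = [] then 1 else 0"]) simp_all
qed

lemma factor_low_rank_column_index: "factor_low_rank TYPE('k::field) n column_index 1"
  unfolding factor_low_rank_def
proof
  fix v :: "nat \<Rightarrow> 'k"
  have "(\<Sum>i<n. of_int (coef (column_index i p) q) * v i)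
      = (if p = [] then 1 else 0) * (\<Sum>i<n. if q = [i] then v i else 0)" for p q
    unfolding sum_distrib_left
    by (intro sum.cong refl, cases p) auto
  then show "low_rank 1 (\<lambda>p q. \<Sum>i<n. of_int (coef (column_index i p) q) * v i)"
    by (intro low_rankI[of "{0::nat}" _ _ "\<lambda>p t. if p = [] then 1 else 0"
          "\<lambda>t q. \<Sum>i<n. if q = [i] then v i else 0"]) simp_all
qed

text \<open>The fibre sums are the coordinates of the image of \<open>v\<close> under the linear map
  \<open>e i \<mapsto> e (m i)\<close>.\<close>

lemma sum_fibres:
  fixes h :: "nat \<Rightarrow> 'k::comm_ring_1" and m :: "nat \<Rightarrow> nat"
  assumes "\<And>i. i < n \<Longrightarrow> m i < N"
  shows "(\<Sum>i<n. h (m i) * v i) = (\<Sum>b<N. (\<Sum>i | i < n \<and> m i = b. v i) * h b)"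
proof -
  have "(\<Sum>i<n. h (m i) * v i) = (\<Sum>b<N. \<Sum>i | i \<in> {..<n} \<and> m i = b. h (m i) * v i)"
    by (rule sum.group[symmetric]) (use assms in auto)
  also have "\<dots> = (\<Sum>b<N. (\<Sum>i | i < n \<and> m i = b. v i) * h b)"
    by (intro sum.cong refl) (simp add: sum_distrib_left mult.commute)
  finally show ?thesis .
qed

text \<open>With \<open>x\<close> the image of \<open>v\<close> in the space of dimension
  \<open>N\<close>, the matrix is that of \<open>e a \<mapsto> x \<and> e a\<close>, to which
  \<open>low_rank_alternating\<close> applies.\<close>

lemma factor_low_rank_wedge:
  assumes "length m = n" "set m \<subseteq> {..<N}"
  shows "factor_low_rank TYPE('k::field) n (wedge N m) (N - 1)"
  unfolding factor_low_rank_def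
proof
  have m: "m ! i < N" if "i < n" for i using assms that by (auto simp: subset_iff)
  fix v :: "nat \<Rightarrow> 'k"
  define x where "x b = (\<Sum>i | i < n \<and> m ! i = b. v i)" for b
  \<comment> \<open>Only the increasing half of the wedge coefficients is recorded; antisymmetrizing
    \<open>g\<close> restores the other half with its sign.\<close>
  define g :: "nat \<Rightarrow> nat \<Rightarrow> nat list \<Rightarrow> 'k" where "g b a q = (if b < a \<and> q = [b, a] then 1 else 0)" for b a q
  let ?M = "\<lambda>a q. if a < N then \<Sum>b<N. x b * (g b a q - g a b q) else 0"
  have g: "of_int (coef (wedge_basis b a) q) = g b a q - g a b q" for a b q
    by (auto simp: wedge_basis_def g_def)
  \<comment> \<open>The rule \<open>remdups_adj.cases\<close> only serves to split lists into empty,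
    singleton and longer ones.\<close>
  have "(\<Sum>i<n. of_int (coef (wedge N m i p) q) * v i)
      = (if length p = 1 \<and> True then ?M (hd p) q else 0)" for p q
    using sum_fibres[of n "(!) m" N "\<lambda>b. g b (hd p) q - g (hd p) b q" v] m
    by (cases p rule: remdups_adj.cases) (auto simp: g x_def)
  then show "low_rank (N - 1) (\<lambda>p q. \<Sum>i<n. of_int (coef (wedge N m i p) q) * v i)"
    using low_rank_reindex[OF low_rank_alternating[of N x g],
        where P = "\<lambda>p. length p = 1" and Q = "\<lambda>_. True" and f = hd and g = "\<lambda>q. q"]
    by presburger
qed

text \<open>Contraction by \<open>x\<close> is the transpose of exterior multiplication, so the
  bound for alternating matrices applies with pairs as rows and single indices as columns.\<close>

lemma factor_low_rank_contract:
  assumes "length m = n" "set m \<subseteq> {..<N}"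
  shows "factor_low_rank TYPE('k::field) n (contract N m) (N - 1)"
  unfolding factor_low_rank_def
proof
  have m: "m ! i < N" if "i < n" for i using assms that by (auto simp: subset_iff)
  fix v :: "nat \<Rightarrow> 'k"
  define x where "x b = (\<Sum>i | i < n \<and> m ! i = b. v i)" for b
  define g :: "nat \<Rightarrow> nat \<Rightarrow> nat list \<Rightarrow> 'k" where "g a d p = (if p = [a, d] then 1 else 0)" for a d p
  let ?M = "\<lambda>d p. if d < N then \<Sum>a<N. x a * (g a d p - g d a p) else 0"
  let ?P = "\<lambda>p. length p = 2 \<and> hd p < N \<and> p ! 1 < N"
  have g: "of_int (coef (contract_basis a b c) [d]) = g a d [b, c] - g d a [b, c]" for a b c d
    unfolding contract_basis_def g_def
    by (cases "a = b"; cases "a = c"; cases "c = d"; cases "b = d") simp_all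
  have "(\<Sum>i<n. of_int (coef (contract N m i p) q) * v i)
      = (if length q = 1 \<and> ?P p then ?M (hd q) p else 0)" for p q
  proof (cases "?P p")
    case True
    then obtain b c where p: "p = [b, c]" "b < N" "c < N"
      by (auto simp: length_Suc_conv numeral_2_eq_2)
    show ?thesis
    proof (cases "length q = 1")
      case True
      then obtain d where q: "q = [d]" by (auto simp: length_Suc_conv)
      have "(\<Sum>i<n. of_int (coef (contract N m i p) q) * v i)
          = (\<Sum>a<N. x a * (g a d p - g d a p))"
        using sum_fibres[of n "(!) m" N "\<lambda>a. g a d p - g d a p" v] m p
        by (simp add: q g x_def)
      \<comment> \<open>The alternating matrix is cut off at \<open>d < N\<close>. Nothing is lost,
        since a pair of indices below \<open>N\<close> contains no such \<open>d\<close>.\<close>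
      moreover have "(\<Sum>a<N. x a * (g a d p - g d a p)) = 0" if "\<not> d < N"
        using that p by (intro sum.neutral) (auto simp: g_def)
      ultimately show ?thesis using p by (simp add: q)
    next
      case False
      then have "coef (contract_basis a b c) q = 0" for a
        by (auto simp: contract_basis_def)
      with False p show ?thesis by simp
    qed
  next
    case False
    then have "contract N m i p = []" for i
      by (cases "(N, m, i, p)" rule: contract.cases) auto
    with False show ?thesis by (subst if_not_P) simp_all
  qed
  then show "low_rank (N - 1) (\<lambda>p q. \<Sum>i<n. of_int (coef (contract N m i p) q) * v i)"
    using low_rank_transpose[OF low_rank_reindex[OF low_rank_alternating[of N x g],
        where P = "\<lambda>q. length q = 1" and Q = ?P and f = hd and g = "\<lambda>p. p"]]
    by presburger
qed

section \<open>Kronecker products of factors\<close>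

text \<open>An entry of the Kronecker product of the matrices assigned to the basis vectors of a
  multi-index; labels of the wrong length give 0.\<close>

fun factors_coef :: "factor list \<Rightarrow> nat list list \<Rightarrow> nat list list \<Rightarrow> nat list \<Rightarrow> int" where
  "factors_coef [] [] [] [] = 1"
| "factors_coef (f # fs) (p # ps) (q # qs) (i # I) = coef (f i p) q * factors_coef fs ps qs I"
| "factors_coef _ _ _ _ = 0"

abbreviation koszul_flattening ::
    "nat list \<Rightarrow> factor list \<Rightarrow> 'k::field tensor \<Rightarrow> nat list list \<Rightarrow> nat list list \<Rightarrow> 'k" where
  "koszul_flattening ns fs \<equiv> flattening ns (\<lambda>ps qs I. of_int (factors_coef fs ps qs I))"

lemma koszul_flattening_pure_Cons:
  "koszul_flattening (n # ns) (f # fs) (pure_tensor (v # vs)) ps qs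
    = (if ps \<noteq> [] \<and> qs \<noteq> [] then
        (\<Sum>i<n. of_int (coef (f i (hd ps)) (hd qs)) * (if i < dim_vec v then v $ i else 0))
          * koszul_flattening ns fs (pure_tensor vs) (tl ps) (tl qs) else 0)"
proof (cases "ps \<noteq> [] \<and> qs \<noteq> []")
  case True
  then show ?thesis
    by (cases ps; cases qs)
       (auto simp: flattening_def sum_multi_indices_Cons pure_tensor_Cons sum_product
          intro!: sum.cong)
next
  case False
  then have "factors_coef (f # fs) ps qs (i # I) = 0" for i I by auto
  then show ?thesis
    unfolding if_not_P[OF False] by (simp add: flattening_def sum_multi_indices_Cons)
qed

text \<open>A pure tensor is sent to the Kronecker product of the matrices of its vectors, so the
  bounds of the factors multiply.\<close>

lemma koszul_flattening_pure:
  fixes vs :: "'k::field vec list"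
  assumes "list_all2 (\<lambda>n (f, s). factor_low_rank TYPE('k) n f s) ns fss" "map dim_vec vs = ns"
  shows "low_rank (prod_list (map snd fss)) (koszul_flattening ns (map fst fss) (pure_tensor vs))"
  using assms
proof (induction arbitrary: vs rule: list_all2_induct)
  case Nil
  have "koszul_flattening [] [] (pure_tensor [] :: 'k tensor) ps qs
      = (if ps = [] then 1 else 0) * (if qs = [] then 1 else 0)" for ps qs
    by (cases ps; cases qs) (simp_all add: flattening_def multi_indices_Nil pure_tensor_Nil)
  then have "low_rank 1 (koszul_flattening [] [] (pure_tensor [] :: 'k tensor))"
    by (intro low_rankI[of "{0::nat}" _ _ "\<lambda>ps t. if ps = [] then 1 else 0"
          "\<lambda>t qs. if qs = [] then 1 else 0"]) simp_all
  then show ?case using Nil by simp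
next
  case (Cons n ns fs' fss)
  obtain f s where fs: "fs' = (f, s)" by (cases fs')
  obtain v vs' where vs: "vs = v # vs'" "map dim_vec vs' = ns" using Cons.prems by auto
  have "low_rank s (\<lambda>p q. \<Sum>i<n. of_int (coef (f i p) q) * (if i < dim_vec v then v $ i else 0))"
    using Cons.hyps(1) by (auto simp: fs factor_low_rank_def)
  \<comment> \<open>Pairs of labels become nonempty lists through head and tail; the mask removes
    the empty list.\<close>
  from low_rank_reindex[OF low_rank_mult[OF this Cons.IH[OF vs(2)]],
      of "\<lambda>ps. ps \<noteq> []" "\<lambda>qs. qs \<noteq> []" "\<lambda>ps. (hd ps, tl ps)" "\<lambda>qs. (hd qs, tl qs)"]
  show ?case
    by (simp add: fs vs(1) koszul_flattening_pure_Cons[abs_def] cong: if_cong)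
qed

section \<open>Entries of the permanent and of its flattening\<close>

text \<open>At most one permutation contributes to a given multi-index, namely the one whose list of
  values it is.\<close>

lemma perm_tensor_entry:
  "(perm_tensor n I :: 'k::field)
    = (if length I = n \<and> distinct I \<and> set I \<subseteq> {..<n} then 1 else 0)"
proof -
  have mi: "I \<in> multi_indices (replicate n n) \<longleftrightarrow> length I = n \<and> set I \<subseteq> {..<n}" for I
    by (auto simp: multi_indices_def list_all2_conv_all_nth set_conv_nth subset_iff)
  have dims: "map dim_vec (map (\<lambda>j. unit_vec n (\<sigma> j) :: 'k vec) [0..<n]) = replicate n n" for \<sigma>
    by (intro nth_equalityI) simp_all
  have perm_less: "\<sigma> j < n" if "\<sigma> permutes {..<n}" "j < n" for \<sigma> j
    using permutes_in_image[OF that(1), of j] that(2) by simp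
  have entry: "(pure_tensor (map (\<lambda>j. unit_vec n (\<sigma> j)) [0..<n]) I :: 'k)
      = (if I = map \<sigma> [0..<n] then 1 else 0)" if \<sigma>: "\<sigma> permutes {..<n}" for \<sigma>
  proof (cases "length I = n \<and> set I \<subseteq> {..<n}")
    case True
    have "pure_tensor (map (\<lambda>j. unit_vec n (\<sigma> j)) [0..<n]) I
        = (\<Prod>j<n. unit_vec n (\<sigma> j) $ (I ! j) :: 'k)"
      unfolding pure_tensor_def using mi[of I] True
      by (auto simp: comp_def map_replicate_const intro!: prod.cong)
    also have "\<dots> = (\<Prod>j<n. if I ! j = \<sigma> j then 1 else 0)"
      using True perm_less[OF \<sigma>] by (intro prod.cong) (auto simp: subset_iff)
    also have "\<dots> = (if \<forall>j<n. I ! j = \<sigma> j then 1 else 0)"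
      by (induction n) (auto simp: less_Suc_eq)
    also have "(\<forall>j<n. I ! j = \<sigma> j) \<longleftrightarrow> I = map \<sigma> [0..<n]"
      using True by (auto intro: nth_equalityI) (metis add_0 diff_zero nth_map_upt)
    finally show ?thesis .
  next
    case False
    then have "I \<notin> multi_indices (map dim_vec (map (\<lambda>j. unit_vec n (\<sigma> j) :: 'k vec) [0..<n]))"
      unfolding dims mi .
    moreover have "I \<noteq> map \<sigma> [0..<n]"
    proof
      assume I: "I = map \<sigma> [0..<n]"
      have "length I = n \<and> set I \<subseteq> {..<n}"
        unfolding I using perm_less[OF \<sigma>] by auto
      with False show False ..
    qed
    ultimately show ?thesis by (simp add: pure_tensor_outside)
  qed
  have fin: "finite {\<sigma>. \<sigma> permutes {..<n}}" by (simp add: finite_permutations)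
  have "(perm_tensor n I :: 'k)
      = (\<Sum>\<sigma> | \<sigma> permutes {..<n}. if I = map \<sigma> [0..<n] then 1 else 0)"
    unfolding perm_tensor_def by (intro sum.cong) (auto simp: entry)
  also have "\<dots> = of_nat (card {\<sigma>. \<sigma> permutes {..<n} \<and> I = map \<sigma> [0..<n]})"
    using fin by (simp add: sum.If_cases Int_def)
  also have "{\<sigma>. \<sigma> permutes {..<n} \<and> I = map \<sigma> [0..<n]}
      = (if length I = n \<and> distinct I \<and> set I \<subseteq> {..<n} then {\<lambda>j. if j < n then I ! j else j} else {})"
  proof (cases "length I = n \<and> distinct I \<and> set I \<subseteq> {..<n}")
    case True
    \<comment> \<open>Outside \<open>{..<n}\<close> a permutation in the sense of
      \<open>permutes\<close> is the identity, which makes it unique.\<close>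
    let ?\<sigma> = "\<lambda>j. if j < n then I ! j else j"
    have "inj_on ?\<sigma> {..<n}"
      using True by (auto simp: inj_on_def nth_eq_iff_index_eq)
    moreover have "?\<sigma> ` {..<n} \<subseteq> {..<n}"
      using True by (auto simp: subset_iff)
    ultimately have "bij_betw ?\<sigma> {..<n} {..<n}"
      using endo_inj_surj[OF finite_lessThan] by (simp only: bij_betw_def)
    then have "?\<sigma> permutes {..<n}"
      by (rule bij_imp_permutes) simp
    moreover have "\<sigma> = ?\<sigma>" if "\<sigma> permutes {..<n}" "I = map \<sigma> [0..<n]" for \<sigma>
      using that by (auto simp: permutes_not_in)
    ultimately show ?thesis using True by (auto intro!: nth_equalityI)
  next
    case False
    have "distinct I \<and> length I = n \<and> set I \<subseteq> {..<n}"
      if "\<sigma> permutes {..<n}" "I = map \<sigma> [0..<n]" for \<sigma>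
      unfolding that(2) using perm_less[OF that(1)] permutes_inj[OF that(1)]
      by (auto simp: distinct_map intro: inj_on_subset)
    with False show ?thesis unfolding if_not_P[OF False] by blast
  qed
  finally show ?thesis by simp
qed

definition arrangements :: "nat \<Rightarrow> nat set \<Rightarrow> nat list set" where
  "arrangements k A = {I. length I = k \<and> distinct I \<and> set I \<subseteq> A}"

lemma finite_arrangements: "finite A \<Longrightarrow> finite (arrangements k A)"
  unfolding arrangements_def
  by (rule finite_subset[OF _ finite_lists_length_eq[of A k]]) auto

text \<open>The set \<open>A\<close> of indices still available is a parameter, so that the sum can
  be expanded along its first factor.\<close>

definition perm_coef :: "factor list \<Rightarrow> nat list list \<Rightarrow> nat list list \<Rightarrow> nat set \<Rightarrow> int" where
  "perm_coef fs ps qs A = (\<Sum>I\<in>arrangements (length fs) A. factors_coef fs ps qs I)"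

text \<open>The entries are images of integers that do not depend on the field, so a single integral
  computation serves all characteristics.\<close>

lemma koszul_flattening_perm:
  assumes "length fs = n"
  shows "koszul_flattening (replicate n n) fs (perm_tensor n) ps qs
    = of_int (perm_coef fs ps qs {..<n})"
proof -
  have mi: "multi_indices (replicate n n) = {I. length I = n \<and> set I \<subseteq> {..<n}}"
    by (auto simp: multi_indices_def list_all2_conv_all_nth set_conv_nth subset_iff)
  have "arrangements n {..<n} \<subseteq> multi_indices (replicate n n)"
    by (auto simp: mi arrangements_def)
  then have "(\<Sum>I\<in>multi_indices (replicate n n). of_int (factors_coef fs ps qs I) * perm_tensor n I)
      = (\<Sum>I\<in>arrangements n {..<n}. of_int (factors_coef fs ps qs I))"
    by (intro sum.mono_neutral_cong_right finite_multi_indices)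
       (auto simp: perm_tensor_entry arrangements_def)
  then show ?thesis unfolding flattening_def perm_coef_def assms of_int_sum .
qed

lemma perm_coef_Nil: "perm_coef [] ps qs A = (if ps = [] \<and> qs = [] then 1 else 0)"
proof -
  have "arrangements 0 A = {[]}" by (auto simp: arrangements_def)
  then show ?thesis by (cases ps; cases qs) (simp_all add: perm_coef_def)
qed

text \<open>Laplace expansion for permanents: the index \<open>i\<close> used by the first factor is
  no longer available to the others.\<close>

lemma perm_coef_Cons:
  assumes "finite A"
  shows "perm_coef (f # fs) (p # ps) (q # qs) A
    = (\<Sum>i\<in>A. coef (f i p) q * perm_coef fs ps qs (A - {i}))"
proof -
  have "arrangements (Suc (length fs)) A
      = (\<lambda>(i, I). i # I) ` (SIGMA i:A. arrangements (length fs) (A - {i}))"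
    by (auto simp: arrangements_def length_Suc_conv image_iff)
  then have "perm_coef (f # fs) (p # ps) (q # qs) A
      = (\<Sum>x\<in>(SIGMA i:A. arrangements (length fs) (A - {i})).
          factors_coef (f # fs) (p # ps) (q # qs) (fst x # snd x))"
    unfolding perm_coef_def
    by (simp only: list.size add_0_right One_nat_def add_Suc_right)
       (subst sum.reindex, auto simp: inj_on_def case_prod_unfold)
  also have "\<dots> = (\<Sum>i\<in>A. \<Sum>I\<in>arrangements (length fs) (A - {i}).
      factors_coef (f # fs) (p # ps) (q # qs) (i # I))"
    using assms by (subst sum.Sigma) (auto simp: finite_arrangements case_prod_unfold)
  finally show ?thesis by (simp add: perm_coef_def sum_distrib_left)
qed

section \<open>Evaluating and combining rows\<close>

text \<open>
  The following functions avoid lambda abstractions because the simplifier, which evaluates them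
  below, would rewrite under the binders. In \<open>perm_row\<close>, \<open>av\<close> lists the indices still to be tried for the
  current tensor factor and \<open>pre\<close> those already tried.
\<close>

fun scale_row :: "nat list \<Rightarrow> int \<Rightarrow> (nat list list \<times> int) list \<Rightarrow> (nat list list \<times> int) list" where
  "scale_row q v [] = []"
| "scale_row q v ((qs, w) # L) = (q # qs, v * w) # scale_row q v L"

fun outer :: "(nat list \<times> int) list \<Rightarrow> (nat list list \<times> int) list \<Rightarrow> (nat list list \<times> int) list" where
  "outer [] L = []"
| "outer ((q, v) # K) L = scale_row q v L @ outer K L"

fun perm_row :: "factor list \<Rightarrow> nat list list \<Rightarrow> nat list \<Rightarrow> nat list \<Rightarrow> (nat list list \<times> int) list" where
  "perm_row [] ps pre av = (if ps = [] then [([], 1)] else [])"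
| "perm_row (f # fs) [] pre av = []"
| "perm_row (f # fs) (p # ps) pre [] = []"
| "perm_row (f # fs) (p # ps) pre (i # av) =
     (if f i p = [] then [] else outer (f i p) (perm_row fs ps [] (pre @ av)))
       @ perm_row (f # fs) (p # ps) (i # pre) av"

lemma coef_scale_row:
  "coef (scale_row q v L) qs = (if qs \<noteq> [] \<and> hd qs = q then v * coef L (tl qs) else 0)"
  by (cases qs; induction q v L rule: scale_row.induct) (auto simp: algebra_simps)

lemma coef_outer:
  "coef (outer K L) qs = (if qs = [] then 0 else coef K (hd qs) * coef L (tl qs))"
  by (induction K L rule: outer.induct) (auto simp: coef_scale_row algebra_simps)

text \<open>Generalized to a nonempty \<open>pre\<close> for the induction: the current factor
  ranges over \<open>av\<close> only, while later factors may use every index of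
  \<open>pre @ av\<close> except the chosen one.\<close>

lemma coef_perm_row_aux:
  assumes "distinct (pre @ av)"
  shows "coef (perm_row fs ps pre av) qs =
    (case (fs, ps, qs) of
      ([], _, _) \<Rightarrow> if ps = [] \<and> qs = [] then 1 else 0
    | (f # fs', p # ps', q # qs') \<Rightarrow>
        \<Sum>i\<in>set av. coef (f i p) q * perm_coef fs' ps' qs' (set (pre @ av) - {i})
    | _ \<Rightarrow> 0)"
  using assms
proof (induction fs ps pre av arbitrary: qs rule: perm_row.induct)
  case (4 f fs p ps pre i av)
  have d: "distinct ([] @ (pre @ av))" "set (pre @ i # av) - {i} = set (pre @ av)"
    using 4(3) by auto
  \<comment> \<open>The induction hypothesis is available only where \<open>perm_row\<close>
    recurses; if \<open>f i p\<close> is empty, the summand for \<open>i\<close> vanishes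
    anyway.\<close>
  have row: "coef (perm_row fs ps [] (pre @ av)) qs' = perm_coef fs ps qs' (set (pre @ av))"
    if "f i p \<noteq> []" for qs'
    using 4(1)[OF that d(1), of qs']
    by (cases fs; cases ps; cases qs')
       (auto simp: perm_coef_Nil perm_coef_Cons, auto simp: perm_coef_def intro!: sum.neutral)
  have "coef (perm_row (f # fs) (p # ps) (i # pre) av) qs = (case qs of [] \<Rightarrow> 0 | q # qs' \<Rightarrow>
      \<Sum>j\<in>set av. coef (f j p) q * perm_coef fs ps qs' (set (pre @ i # av) - {j}))"
    using 4(2)[of qs] 4(3) by (auto split: list.split)
  then show ?case
    using 4(3) d(2) by (auto simp: coef_outer row split: list.split)
qed (auto split: list.split)

lemma coef_perm_row:
  assumes "distinct av"
  shows "coef (perm_row fs ps [] av) qs = perm_coef fs ps qs (set av)"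
proof -
  have "perm_coef fs ps qs (set av) = 0" if "fs \<noteq> []" "ps = [] \<or> qs = []"
    using that unfolding perm_coef_def
    by (intro sum.neutral) (cases fs; cases ps; auto)
  then show ?thesis
    using coef_perm_row_aux[of "[]" av fs ps qs] assms
    by (cases fs; cases ps; cases qs) (auto simp: perm_coef_Nil perm_coef_Cons)
qed

fun add_entry :: "'a \<Rightarrow> int \<Rightarrow> ('a \<times> int) list \<Rightarrow> ('a \<times> int) list" where
  "add_entry q v [] = [(q, v)]"
| "add_entry q v ((q', v') # L) =
     (if q = q' then (q', v + v') # L else (q', v') # add_entry q v L)"

fun add_row :: "int \<Rightarrow> ('a \<times> int) list \<Rightarrow> ('a \<times> int) list \<Rightarrow> ('a \<times> int) list" where
  "add_row c [] L = L"
| "add_row c ((q, v) # K) L = add_row c K (add_entry q (c * v) L)"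

fun combine_rows ::
    "factor list \<Rightarrow> nat list \<Rightarrow> (int \<times> nat list list) list \<Rightarrow> (nat list list \<times> int) list" where
  "combine_rows fs av [] = []"
| "combine_rows fs av ((c, ps) # X) = add_row c (perm_row fs ps [] av) (combine_rows fs av X)"

lemma coef_add_entry: "coef (add_entry q v L) q' = (if q = q' then v else 0) + coef L q'"
  by (induction q v L rule: add_entry.induct) auto

lemma coef_add_row: "coef (add_row c K L) q = c * coef K q + coef L q"
  by (induction c K L rule: add_row.induct) (auto simp: coef_add_entry algebra_simps)

lemma coef_combine_rows:
  assumes "distinct av"
  shows "coef (combine_rows fs av X) qs = (\<Sum>(c, ps)\<leftarrow>X. c * perm_coef fs ps qs (set av))"
  using assms by (induction X) (auto simp: coef_add_row coef_perm_row)

text \<open>The order is lexicographic as long as all indices are below \<open>5\<close>.\<close>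

definition column_key :: "nat list list \<Rightarrow> int" where
  "column_key qs = foldl (\<lambda>k x. 5 * k + int x) 0 (concat qs)"

text \<open>The allowed pivots are nonzero in every field of characteristic other than 2. Entries
  that have cancelled stay in the list, hence the alternative \<open>v = 0\<close>.\<close>

fun echelon_row :: "nat list list \<Rightarrow> (nat list list \<times> int) list \<Rightarrow> bool" where
  "echelon_row qs L \<longleftrightarrow> coef L qs \<in> {1, - 1, 2, - 2, 4, - 4}
     \<and> list_all (\<lambda>(q, v). v = 0 \<or> q = qs \<or> column_key qs < column_key q) L"

text \<open>Each pivot column comes with the combination of rows whose leading entry lies in that column.\<close>

definition echelon_certificate ::
    "factor list \<Rightarrow> nat list \<Rightarrow> (nat list list \<times> (int \<times> nat list list) list) list \<Rightarrow> bool" where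
  "echelon_certificate fs av C \<longleftrightarrow> successively (<) (map (\<lambda>x. column_key (fst x)) C)
     \<and> list_all (\<lambda>(qs, X). echelon_row qs (combine_rows fs av X)) C"

section \<open>From certificates to border rank\<close>

lemma coef_eq_0:
  assumes "list_all (\<lambda>(q, v). v = 0 \<or> q = qs \<or> column_key qs < column_key q) L"
    "column_key qs' < column_key qs"
  shows "coef L qs' = 0"
  using assms by (induction L) auto

lemma of_int_pivot_nonzero:
  assumes "CHAR('k::field) \<noteq> 2" "c \<in> {1, - 1, 2, - 2, 4, - 4}"
  shows "(of_int c :: 'k) \<noteq> 0"
proof -
  \<comment> \<open>Were 2 zero, the characteristic would divide 2; it is neither 1 nor 2.\<close>
  have "of_nat 2 \<noteq> (0 :: 'k)"
    unfolding of_nat_eq_0_iff_char_dvd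
    using assms(1) CHAR_not_1[where 'a = 'k] two_is_prime_nat
    by (auto simp: prime_nat_iff)
  then have "(2 :: 'k) \<noteq> 0" by simp
  moreover from this have "(4 :: 'k) \<noteq> 0"
    by (metis mult_2_right mult_eq_0_iff numeral_Bit0 mult_2)
  ultimately show ?thesis using assms(2) by auto
qed

text \<open>On the pivot columns the certified row combinations form an upper triangular matrix with
  the pivots on its diagonal. This is the nonvanishing minor required by
  \<open>border_rank_greater\<close>.\<close>

theorem border_rank_perm_greater:
  assumes char: "CHAR('k::field) \<noteq> 2"
    and low: "list_all2 (\<lambda>n (f, s). factor_low_rank TYPE('k) n f s) (replicate n n) fss"
    and n: "n \<noteq> 0"
    and cert: "echelon_certificate (map fst fss) [0..<n] C"
    and less: "k * prod_list (map snd fss) < length C"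
  shows "k < border_rank (replicate n n) (perm_tensor n :: 'k tensor)"
proof -
  let ?fs = "map fst fss"
  have len: "length ?fs = n" using list_all2_lengthD[OF low] by simp
  define pivot where "pivot j = fst (C ! j)" for j
  define X where "X i = snd (C ! i)" for i
  \<comment> \<open>The row combinations and the choice of pivot columns are built into the linear
    forms, so that the new flattening is indexed by natural numbers.\<close>
  define cf :: "nat \<Rightarrow> nat \<Rightarrow> nat list \<Rightarrow> 'k" where
    "cf i j I = (\<Sum>x\<leftarrow>X i. of_int (fst x) * of_int (factors_coef ?fs (snd x) (pivot j) I))" for i j I
  have cf: "flattening (replicate n n) cf S i j
      = (\<Sum>x\<leftarrow>X i. of_int (fst x) * koszul_flattening (replicate n n) ?fs S (snd x) (pivot j))"
    for S i j
  proof -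
    have "(\<Sum>I\<in>J. (\<Sum>x\<leftarrow>xs. of_int (fst x) * of_int (factors_coef ?fs (snd x) q I)) * S I)
        = (\<Sum>x\<leftarrow>xs. of_int (fst x) * (\<Sum>I\<in>J. of_int (factors_coef ?fs (snd x) q I) * S I))"
      for J xs q
      by (induction xs) (simp_all add: sum.distrib sum_distrib_left algebra_simps)
    then show ?thesis by (simp add: flattening_def cf_def)
  qed
  define G where "G i j = coef (combine_rows ?fs [0..<n] (X i)) (pivot j)" for i j
  have G: "flattening (replicate n n) cf (perm_tensor n) i j = of_int (G i j)" for i j
  proof -
    have "(\<Sum>x\<leftarrow>xs. of_int (fst x) * of_int (perm_coef ?fs (snd x) q {..<n}))
        = (of_int (\<Sum>(c, ps)\<leftarrow>xs. c * perm_coef ?fs ps q {..<n}) :: 'k)" for xs q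
      by (induction xs) (auto simp: case_prod_unfold)
    then show ?thesis
      by (simp add: cf koszul_flattening_perm[OF len] G_def coef_combine_rows atLeast0LessThan)
  qed
  have rows: "echelon_row (pivot i) (combine_rows ?fs [0..<n] (X i))" if "i < length C" for i
    using cert that
    by (auto simp: echelon_certificate_def list_all_length pivot_def X_def case_prod_unfold)
  have keys: "column_key (pivot i) < column_key (pivot j)" if "i < j" "j < length C" for i j
  proof -
    have "sorted_wrt (<) (map (\<lambda>x. column_key (fst x)) C)"
      using cert unfolding echelon_certificate_def
      by (subst (asm) successively_conv_sorted_wrt) auto
    then show ?thesis using that by (auto simp: sorted_wrt_iff_nth_less pivot_def)
  qed
  \<comment> \<open>Earlier pivot columns have smaller keys, and row \<open>i\<close> has no nonzero
    entry before its own pivot.\<close>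
  have lower: "G i j = 0" if "j < i" "i < length C" for i j
    unfolding G_def using rows[OF that(2)] keys[OF that] by (auto intro: coef_eq_0)
  have diag: "(of_int (G i i) :: 'k) \<noteq> 0" if "i < length C" for i
    unfolding G_def using rows[OF that] by (intro of_int_pivot_nonzero[OF char]) auto
  show ?thesis
  proof (rule border_rank_greater[where cf = cf])
    show "low_rank (prod_list (map snd fss)) (flattening (replicate n n) cf (pure_tensor vs))"
      if "map dim_vec vs = replicate n n" for vs :: "'k vec list"
      unfolding cf[abs_def] by (rule low_rank_combination[OF koszul_flattening_pure[OF low that]])
    let ?M = "mat (length C) (length C) (\<lambda>(i, j). of_int (G i j) :: 'k)"
    have "det ?M = prod_list (diag_mat ?M)"
      by (rule det_upper_triangular[of _ "length C"]) (auto simp: lower)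
    moreover have "prod_list (diag_mat ?M) \<noteq> 0"
      by (auto simp: prod_list_zero_iff diag_mat_def diag)
    ultimately show "det (mat (length C) (length C)
        (\<lambda>(i, j). flattening (replicate n n) cf (perm_tensor n) i j)) \<noteq> 0"
      by (simp add: G)
  qed (use n less in \<open>auto intro: perm_tensor_in_tensor_space\<close>)
qed

section \<open>The permanents of order 4 and 5\<close>

text \<open>
  The maps in \<open>factors5\<close> and the certificates were found by a computer search. The flattening of the
  permanent of order 4 has rank 70, which exceeds \<open>7 * 9\<close>, and that of order 5 has rank 255, which exceeds
  \<open>14 * 18\<close>; the certificates only contain the rows needed for these bounds.
\<close>

definition factors4 :: "factor list" where
  "factors4 = [row_index, wedge 4 [0, 1, 2, 3], contract 4 [0, 1, 2, 3], column_index]"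

definition factors5 :: "factor list" where
  "factors5 = [row_index, wedge 3 [2, 2, 1, 2, 0], contract 4 [2, 1, 0, 0, 3], column_index,
     wedge 4 [1, 2, 0, 3, 0]]"

definition certificate4 :: "(nat list list \<times> (int \<times> nat list list) list) list" where
  "certificate4 = [
    ([[], [0,1], [0], [0]], [(1, [[2], [0], [0,3], []])]),
    ([[], [0,1], [0], [1]], [(1, [[2], [1], [0,3], []])]),
    ([[], [0,1], [0], [2]], [(1, [[0], [0], [0,3], []])]),
    ([[], [0,1], [0], [3]], [(1, [[0], [0], [0,2], []])]),
    ([[], [0,1], [1], [0]], [(1, [[2], [0], [1,3], []])]),
    ([[], [0,1], [1], [1]], [(1, [[2], [1], [1,3], []])]),
    ([[], [0,1], [1], [2]], [(1, [[1], [1], [1,3], []])]),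
    ([[], [0,1], [1], [3]], [(1, [[1], [1], [1,2], []])]),
    ([[], [0,1], [2], [0]], [(1, [[2], [0], [2,3], []])]),
    ([[], [0,1], [2], [1]], [(1, [[2], [1], [2,3], []])]),
    ([[], [0,1], [2], [2]], [(1, [[0], [0], [2,3], []])]),
    ([[], [0,1], [2], [3]], [(1, [[2], [0], [0,2], []])]),
    ([[], [0,1], [3], [0]], [(1, [[3], [0], [2,3], []])]),
    ([[], [0,1], [3], [1]], [(1, [[3], [1], [2,3], []])]),
    ([[], [0,1], [3], [2]], [(1, [[3], [0], [0,3], []])]),
    ([[], [0,2], [0], [0]], [(1, [[1], [0], [0,3], []])]),
    ([[], [0,2], [0], [1]], [(1, [[3], [2], [0,2], []])]),
    ([[], [0,2], [0], [2]], [(1, [[1], [2], [0,3], []])]),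
    ([[], [0,2], [0], [3]], [(1, [[0], [0], [0,1], []])]),
    ([[], [0,2], [1], [0]], [(1, [[1], [0], [1,3], []])]),
    ([[], [0,2], [1], [1]], [(1, [[3], [2], [1,2], []])]),
    ([[], [0,2], [1], [2]], [(1, [[1], [2], [1,3], []])]),
    ([[], [0,2], [1], [3]], [(1, [[1], [0], [0,1], []])]),
    ([[], [0,2], [2], [0]], [(1, [[1], [0], [2,3], []])]),
    ([[], [0,2], [2], [1]], [(1, [[2], [2], [2,3], []])]),
    ([[], [0,2], [2], [2]], [(1, [[1], [2], [2,3], []])]),
    ([[], [0,2], [2], [3]], [(1, [[2], [2], [1,2], []])]),
    ([[], [0,2], [3], [0]], [(1, [[3], [0], [1,3], []])]),
    ([[], [0,2], [3], [1]], [(1, [[3], [2], [2,3], []])]),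
    ([[], [0,2], [3], [2]], [(1, [[3], [2], [1,3], []])]),
    ([[], [0,3], [0], [1]], [(1, [[2], [3], [0,3], []])]),
    ([[], [0,3], [0], [2]], [(1, [[1], [3], [0,3], []])]),
    ([[], [0,3], [0], [3]], [(1, [[1], [3], [0,2], []])]),
    ([[], [0,3], [1], [0]], [(1, [[1], [0], [1,2], []])]),
    ([[], [0,3], [1], [1]], [(1, [[2], [3], [1,3], []])]),
    ([[], [0,3], [1], [2]], [(1, [[1], [3], [1,3], []])]),
    ([[], [0,3], [1], [3]], [(1, [[1], [3], [1,2], []])]),
    ([[], [0,3], [2], [0]], [(1, [[2], [0], [1,2], []])]),
    ([[], [0,3], [2], [1]], [(1, [[2], [3], [2,3], []])]),
    ([[], [0,3], [2], [2]], [(1, [[1], [3], [2,3], []])]),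
    ([[], [0,3], [2], [3]], [(1, [[2], [3], [1,2], []])]),
    ([[], [0,3], [3], [1]], [(1, [[3], [3], [2,3], []])]),
    ([[], [0,3], [3], [2]], [(1, [[3], [3], [1,3], []])]),
    ([[], [1,2], [0], [1]], [(1, [[0], [1], [0,3], []])]),
    ([[], [1,2], [0], [2]], [(1, [[0], [2], [0,3], []])]),
    ([[], [1,2], [0], [3]], [(1, [[0], [1], [0,1], []])]),
    ([[], [1,2], [1], [1]], [(1, [[0], [1], [1,3], []])]),
    ([[], [1,2], [1], [2]], [(1, [[0], [2], [1,3], []])]),
    ([[], [1,2], [1], [3]], [(1, [[1], [1], [0,1], []])]),
    ([[], [1,2], [2], [1]], [(1, [[0], [1], [2,3], []])]),
    ([[], [1,2], [2], [2]], [(1, [[0], [2], [2,3], []])]),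
    ([[], [1,2], [2], [3]], [(1, [[2], [2], [0,2], []])]),
    ([[], [1,2], [3], [1]], [(1, [[3], [1], [0,3], []])]),
    ([[], [1,2], [3], [2]], [(1, [[3], [2], [0,3], []])]),
    ([[], [1,3], [0], [1]], [(1, [[0], [1], [0,2], []])]),
    ([[], [1,3], [0], [2]], [(1, [[0], [3], [0,3], []])]),
    ([[], [1,3], [0], [3]], [(1, [[0], [3], [0,2], []])]),
    ([[], [1,3], [1], [2]], [(1, [[0], [3], [1,3], []])]),
    ([[], [1,3], [1], [3]], [(1, [[0], [3], [1,2], []])]),
    ([[], [1,3], [2], [1]], [(1, [[2], [1], [0,2], []])]),
    ([[], [1,3], [2], [2]], [(1, [[0], [3], [2,3], []])]),
    ([[], [1,3], [2], [3]], [(1, [[2], [3], [0,2], []])]),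
    ([[], [1,3], [3], [2]], [(1, [[3], [3], [0,3], []])]),
    ([[], [2,3], [0], [2]], [(1, [[0], [2], [0,1], []])])]"

definition certificate5 :: "(nat list list \<times> (int \<times> nat list list) list) list" where
  "certificate5 = [
    ([[], [0,1], [0], [0], [0,1]], [(1, [[3], [0], [0,1], [], [1]])]),
    ([[], [0,1], [0], [0], [0,2]], [(1, [[3], [0], [0,3], [], [0]])]),
    ([[], [0,1], [0], [0], [0,3]], [(1, [[1], [0], [0,3], [], [0]])]),
    ([[], [0,1], [0], [0], [1,2]], [(1, [[3], [0], [0,3], [], [1]])]),
    ([[], [0,1], [0], [0], [1,3]], [(1, [[2], [1], [0,1], [], [1]])]),
    ([[], [0,1], [0], [0], [2,3]], [(1, [[2], [1], [0,1], [], [2]])]),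
    ([[], [0,1], [0], [1], [0,1]], [(1, [[3], [0], [0,2], [], [1]])]),
    ([[], [0,1], [0], [1], [0,2]], [(1, [[3], [0], [0,2], [], [2]])]),
    ([[], [0,1], [0], [1], [0,3]], [(1, [[0], [0], [0,3], [], [0]])]),
    ([[], [0,1], [0], [1], [1,2]], [(1, [[3], [0], [0,3], [], [2]])]),
    ([[], [0,1], [0], [1], [1,3]], [(1, [[2], [1], [0,2], [], [1]])]),
    ([[], [0,1], [0], [1], [2,3]], [(1, [[2], [1], [0,2], [], [2]])]),
    ([[], [0,1], [0], [2], [0,1]], [(1, [[3], [1], [0,1], [], [0]])]),
    ([[], [0,1], [0], [2], [0,2]], [(1, [[3], [1], [0,2], [], [0]])]),
    ([[], [0,1], [0], [2], [0,3]], [(1, [[0], [1], [0,1], [], [0]])]),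
    ([[], [0,1], [0], [2], [1,2]], [(1, [[3], [1], [0,2], [], [1]]), (1, [[3], [0], [0,2], [], [1]])]),
    ([[], [0,1], [0], [2], [1,3]], [(1, [[1], [1], [0,2], [], [1]])]),
    ([[], [0,1], [0], [2], [2,3]], [(1, [[0], [1], [0,1], [], [2]])]),
    ([[], [0,1], [0], [3], [0,1]], [(1, [[1], [0], [0,2], [], [1]])]),
    ([[], [0,1], [0], [3], [0,2]], [(1, [[0], [0], [0,1], [], [2]])]),
    ([[], [0,1], [0], [3], [0,3]], [(1, [[0], [0], [0,1], [], [3]])]),
    ([[], [0,1], [0], [3], [1,3]], [(1, [[2], [1], [0,1], [], [3]])]),
    ([[], [0,1], [0], [3], [2,3]], [(1, [[2], [1], [0,2], [], [3]])]),
    ([[], [0,1], [0], [4], [0,1]], [(1, [[3], [0], [0,1], [], [0]])]),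
    ([[], [0,1], [0], [4], [0,2]], [(1, [[3], [0], [0,2], [], [0]])]),
    ([[], [0,1], [0], [4], [0,3]], [(1, [[0], [0], [0,1], [], [0]])]),
    ([[], [0,1], [1], [0], [0,1]], [(1, [[1], [0], [0,1], [], [1]])]),
    ([[], [0,1], [1], [0], [0,2]], [(1, [[3], [0], [1,3], [], [0]])]),
    ([[], [0,1], [1], [0], [0,3]], [(1, [[1], [0], [1,3], [], [0]])]),
    ([[], [0,1], [1], [0], [1,2]], [(1, [[3], [0], [1,3], [], [1]])]),
    ([[], [0,1], [1], [0], [1,3]], [(1, [[1], [0], [1,3], [], [1]])]),
    ([[], [0,1], [1], [0], [2,3]], [(1, [[1], [0], [1,3], [], [2]])]),
    ([[], [0,1], [1], [1], [0,1]], [(1, [[3], [0], [1,2], [], [1]])]),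
    ([[], [0,1], [1], [1], [0,2]], [(1, [[3], [0], [1,2], [], [2]])]),
    ([[], [0,1], [1], [1], [0,3]], [(1, [[0], [0], [1,3], [], [0]])]),
    ([[], [0,1], [1], [1], [1,2]], [(1, [[3], [0], [1,3], [], [2]])]),
    ([[], [0,1], [1], [1], [1,3]], [(1, [[0], [0], [1,3], [], [1]])]),
    ([[], [0,1], [1], [1], [2,3]], [(1, [[0], [0], [1,3], [], [2]])]),
    ([[], [0,1], [1], [2], [0,1]], [(1, [[1], [1], [0,1], [], [0]]), (-1, [[1], [0], [1,3], [], [0]])]),
    ([[], [0,1], [1], [2], [0,2]], [(1, [[3], [1], [1,2], [], [0]])]),
    ([[], [0,1], [1], [2], [0,3]], [(1, [[1], [1], [1,2], [], [0]])]),
    ([[], [0,1], [1], [2], [1,2]], [(1, [[3], [1], [1,2], [], [1]]), (1, [[3], [0], [1,2], [], [1]])]),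
    ([[], [0,1], [1], [2], [1,3]], [(1, [[1], [1], [1,2], [], [1]])]),
    ([[], [0,1], [1], [2], [2,3]], [(1, [[1], [1], [1,2], [], [2]])]),
    ([[], [0,1], [1], [3], [0,1]], [(1, [[1], [0], [1,2], [], [1]])]),
    ([[], [0,1], [1], [3], [0,2]], [(1, [[1], [0], [1,2], [], [2]])]),
    ([[], [0,1], [1], [3], [0,3]], [(1, [[1], [0], [1,2], [], [3]])]),
    ([[], [0,1], [1], [3], [1,3]], [(1, [[1], [0], [1,3], [], [3]])]),
    ([[], [0,1], [1], [3], [2,3]], [(1, [[0], [0], [1,3], [], [3]])]),
    ([[], [0,1], [1], [4], [0,1]], [(1, [[1], [0], [0,1], [], [0]])]),
    ([[], [0,1], [1], [4], [0,2]], [(1, [[3], [0], [1,2], [], [0]])]),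
    ([[], [0,1], [1], [4], [0,3]], [(1, [[1], [0], [1,2], [], [0]])]),
    ([[], [0,1], [2], [0], [0,1]], [(1, [[1], [0], [0,1], [], [2]]), (-1, [[3], [0], [1,3], [], [0]]), (-1, [[3], [0], [1,2], [], [1]])]),
    ([[], [0,1], [2], [0], [0,2]], [(1, [[3], [0], [2,3], [], [0]])]),
    ([[], [0,1], [2], [0], [0,3]], [(1, [[1], [0], [2,3], [], [0]])]),
    ([[], [0,1], [2], [0], [1,2]], [(1, [[3], [0], [2,3], [], [1]])]),
    ([[], [0,1], [2], [0], [1,3]], [(1, [[1], [0], [2,3], [], [1]])]),
    ([[], [0,1], [2], [0], [2,3]], [(1, [[1], [0], [2,3], [], [2]])]),
    ([[], [0,1], [2], [1], [0,1]], [(1, [[0], [0], [0,2], [], [1]])]),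
    ([[], [0,1], [2], [1], [0,2]], [(1, [[0], [0], [0,2], [], [2]])]),
    ([[], [0,1], [2], [1], [0,3]], [(1, [[0], [0], [2,3], [], [0]])]),
    ([[], [0,1], [2], [1], [1,2]], [(1, [[3], [0], [2,3], [], [2]])]),
    ([[], [0,1], [2], [1], [1,3]], [(1, [[0], [0], [2,3], [], [1]])]),
    ([[], [0,1], [2], [1], [2,3]], [(1, [[0], [0], [2,3], [], [2]])]),
    ([[], [0,1], [2], [2], [0,2]], [(1, [[0], [1], [0,2], [], [0]]), (-1, [[0], [0], [2,3], [], [0]])]),
    ([[], [0,1], [2], [2], [0,3]], [(1, [[0], [1], [1,2], [], [0]])]),
    ([[], [0,1], [2], [2], [1,2]], [(1, [[3], [1], [1,2], [], [2]]), (1, [[3], [0], [1,2], [], [2]])]),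
    ([[], [0,1], [2], [2], [1,3]], [(1, [[0], [1], [1,2], [], [1]])]),
    ([[], [0,1], [2], [2], [2,3]], [(1, [[0], [1], [1,2], [], [2]])]),
    ([[], [0,1], [2], [3], [0,1]], [(1, [[0], [0], [1,2], [], [1]])]),
    ([[], [0,1], [2], [3], [0,2]], [(1, [[0], [0], [1,2], [], [2]])]),
    ([[], [0,1], [2], [3], [0,3]], [(1, [[0], [0], [1,2], [], [3]])]),
    ([[], [0,1], [2], [3], [1,3]], [(1, [[1], [0], [2,3], [], [3]])]),
    ([[], [0,1], [2], [3], [2,3]], [(1, [[0], [0], [2,3], [], [3]])]),
    ([[], [0,1], [2], [4], [0,2]], [(1, [[0], [0], [0,2], [], [0]])]),
    ([[], [0,1], [2], [4], [0,3]], [(1, [[0], [0], [1,2], [], [0]])]),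
    ([[], [0,1], [3], [0], [0,1]], [(1, [[3], [1], [1,3], [], [1]])]),
    ([[], [0,1], [3], [0], [0,2]], [(1, [[3], [1], [0,3], [], [0]])]),
    ([[], [0,1], [3], [0], [0,3]], [(1, [[4], [0], [1,3], [], [0]])]),
    ([[], [0,1], [3], [0], [1,2]], [(1, [[3], [1], [0,3], [], [1]])]),
    ([[], [0,1], [3], [0], [1,3]], [(1, [[4], [0], [1,3], [], [1]])]),
    ([[], [0,1], [3], [0], [2,3]], [(1, [[4], [0], [1,3], [], [2]])]),
    ([[], [0,1], [3], [1], [0,1]], [(1, [[3], [1], [2,3], [], [1]])]),
    ([[], [0,1], [3], [1], [0,2]], [(1, [[3], [1], [2,3], [], [2]])]),
    ([[], [0,1], [3], [1], [0,3]], [(1, [[4], [0], [2,3], [], [0]])]),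
    ([[], [0,1], [3], [1], [1,2]], [(1, [[3], [1], [0,3], [], [2]])]),
    ([[], [0,1], [3], [1], [1,3]], [(1, [[4], [0], [2,3], [], [1]])]),
    ([[], [0,1], [3], [1], [2,3]], [(1, [[4], [0], [2,3], [], [2]])]),
    ([[], [0,1], [3], [2], [0,1]], [(1, [[3], [1], [1,3], [], [0]])]),
    ([[], [0,1], [3], [2], [0,2]], [(1, [[3], [1], [2,3], [], [0]])]),
    ([[], [0,1], [3], [2], [0,3]], [(1, [[0], [1], [1,3], [], [0]])]),
    ([[], [0,1], [3], [2], [1,3]], [(1, [[1], [1], [2,3], [], [1]])]),
    ([[], [0,1], [3], [2], [2,3]], [(1, [[0], [1], [1,3], [], [2]])]),
    ([[], [0,1], [3], [3], [0,3]], [(1, [[0], [1], [1,3], [], [3]])]),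
    ([[], [0,1], [3], [3], [1,3]], [(1, [[4], [0], [1,3], [], [3]])]),
    ([[], [0,1], [3], [3], [2,3]], [(1, [[4], [0], [2,3], [], [3]])]),
    ([[], [0,2], [0], [0], [0,1]], [(1, [[3], [2], [0,1], [], [1]])]),
    ([[], [0,2], [0], [0], [0,2]], [(1, [[3], [2], [0,1], [], [2]])]),
    ([[], [0,2], [0], [0], [0,3]], [(1, [[2], [2], [0,1], [], [0]])]),
    ([[], [0,2], [0], [0], [1,2]], [(1, [[2], [0], [0,3], [], [1]])]),
    ([[], [0,2], [0], [0], [1,3]], [(1, [[2], [2], [0,1], [], [1]])]),
    ([[], [0,2], [0], [0], [2,3]], [(1, [[2], [2], [0,1], [], [2]])]),
    ([[], [0,2], [0], [1], [0,1]], [(1, [[3], [2], [0,2], [], [1]])]),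
    ([[], [0,2], [0], [1], [0,2]], [(1, [[3], [2], [0,2], [], [2]])]),
    ([[], [0,2], [0], [1], [0,3]], [(1, [[2], [2], [0,2], [], [0]])]),
    ([[], [0,2], [0], [1], [1,2]], [(1, [[2], [0], [0,3], [], [2]]), (1, [[2], [2], [0,1], [], [2]])]),
    ([[], [0,2], [0], [1], [1,3]], [(1, [[2], [2], [0,2], [], [1]])]),
    ([[], [0,2], [0], [1], [2,3]], [(1, [[2], [2], [0,2], [], [2]])]),
    ([[], [0,2], [0], [2], [0,1]], [(1, [[3], [2], [0,1], [], [0]])]),
    ([[], [0,2], [0], [2], [0,2]], [(1, [[3], [2], [0,2], [], [0]])]),
    ([[], [0,2], [0], [2], [0,3]], [(1, [[0], [2], [0,1], [], [0]])]),
    ([[], [0,2], [0], [2], [1,2]], [(1, [[2], [0], [0,1], [], [2]]), (1, [[3], [2], [0,1], [], [2]])]),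
    ([[], [0,2], [0], [2], [1,3]], [(1, [[1], [2], [0,2], [], [1]])]),
    ([[], [0,2], [0], [2], [2,3]], [(1, [[0], [2], [0,1], [], [2]])]),
    ([[], [0,2], [0], [3], [0,1]], [(1, [[2], [0], [0,1], [], [1]]), (1, [[3], [2], [0,1], [], [1]])]),
    ([[], [0,2], [0], [3], [0,2]], [(1, [[2], [0], [0,2], [], [2]]), (1, [[3], [2], [0,2], [], [2]])]),
    ([[], [0,2], [0], [3], [0,3]], [(1, [[0], [2], [0,1], [], [3]])]),
    ([[], [0,2], [0], [3], [1,3]], [(1, [[2], [2], [0,1], [], [3]])]),
    ([[], [0,2], [0], [3], [2,3]], [(1, [[2], [2], [0,2], [], [3]])]),
    ([[], [0,2], [0], [4], [0,1]], [(1, [[2], [0], [0,1], [], [0]])]),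
    ([[], [0,2], [0], [4], [0,2]], [(1, [[2], [0], [0,2], [], [0]])]),
    ([[], [0,2], [0], [4], [0,3]], [(1, [[3], [1], [0,1], [], [1]]), (1, [[3], [0], [0,1], [], [1]]), (-1, [[3], [0], [1,3], [], [1]]), (-1, [[3], [1], [1,3], [], [1]]), (-1, [[3], [2], [0,1], [], [0]]), (1, [[2], [0], [0,1], [], [0]])]),
    ([[], [0,2], [1], [0], [0,1]], [(1, [[1], [2], [0,1], [], [1]])]),
    ([[], [0,2], [1], [0], [0,2]], [(1, [[1], [2], [0,1], [], [2]])]),
    ([[], [0,2], [1], [0], [0,3]], [(1, [[1], [2], [0,1], [], [0]])]),
    ([[], [0,2], [1], [0], [1,2]], [(1, [[2], [0], [1,3], [], [1]])]),
    ([[], [0,2], [1], [0], [1,3]], [(1, [[1], [1], [0,1], [], [1]]), (1, [[1], [0], [0,1], [], [1]]), (-1, [[1], [0], [1,3], [], [1]]), (2, [[1], [2], [0,1], [], [1]])]),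
    ([[], [0,2], [1], [0], [2,3]], [(1, [[2], [0], [1,3], [], [3]])]),
    ([[], [0,2], [1], [1], [0,1]], [(1, [[3], [2], [1,2], [], [1]])]),
    ([[], [0,2], [1], [1], [0,2]], [(1, [[3], [2], [1,2], [], [2]])]),
    ([[], [0,2], [1], [1], [0,3]], [(1, [[2], [2], [1,2], [], [0]])]),
    ([[], [0,2], [1], [1], [1,2]], [(1, [[2], [0], [1,3], [], [2]]), (1, [[2], [0], [1,3], [], [3]])]),
    ([[], [0,2], [1], [1], [1,3]], [(1, [[2], [2], [1,2], [], [1]])]),
    ([[], [0,2], [1], [1], [2,3]], [(1, [[2], [2], [1,2], [], [2]])]),
    ([[], [0,2], [1], [2], [0,1]], [(1, [[1], [2], [0,1], [], [3]]), (1, [[1], [2], [0,1], [], [0]])]),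
    ([[], [0,2], [1], [2], [0,2]], [(1, [[3], [2], [1,2], [], [0]])]),
    ([[], [0,2], [1], [2], [0,3]], [(1, [[1], [2], [1,2], [], [0]])]),
    ([[], [0,2], [1], [2], [1,2]], [(1, [[2], [0], [1,2], [], [1]]), (1, [[3], [2], [1,2], [], [1]])]),
    ([[], [0,2], [1], [2], [1,3]], [(1, [[1], [2], [1,2], [], [1]])]),
    ([[], [0,2], [1], [2], [2,3]], [(1, [[1], [2], [1,2], [], [2]])]),
    ([[], [0,2], [1], [3], [0,1]], [(1, [[1], [0], [0,1], [], [3]]), (-1, [[1], [0], [1,3], [], [0]]), (-1, [[1], [0], [1,2], [], [1]]), (1, [[1], [2], [0,1], [], [3]]), (-1, [[1], [2], [1,2], [], [1]])]),
    ([[], [0,2], [1], [3], [0,2]], [(1, [[2], [0], [1,2], [], [3]]), (-1, [[2], [2], [1,2], [], [0]])]),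
    ([[], [0,2], [1], [3], [0,3]], [(1, [[1], [2], [1,2], [], [3]])]),
    ([[], [0,2], [1], [3], [1,3]], [(1, [[2], [0], [1,3], [], [0]]), (1, [[1], [2], [0,1], [], [2]]), (1, [[2], [0], [1,3], [], [3]]), (-1, [[3], [2], [1,2], [], [1]]), (1, [[2], [2], [1,2], [], [0]]), (-1, [[2], [2], [1,2], [], [1]]), (1, [[1], [2], [0,1], [], [3]]), (-1, [[1], [2], [1,2], [], [1]])]),
    ([[], [0,2], [1], [3], [2,3]], [(1, [[2], [2], [1,2], [], [3]])]),
    ([[], [0,2], [1], [4], [0,1]], [(1, [[2], [0], [0,1], [], [3]]), (-1, [[2], [2], [0,1], [], [0]]), (1, [[2], [0], [0,1], [], [1]]), (1, [[3], [2], [0,1], [], [1]]), (1, [[0], [2], [0,1], [], [3]]), (1, [[1], [2], [0,1], [], [1]]), (-1, [[2], [0], [1,3], [], [1]]), (1, [[2], [0], [1,2], [], [1]]), (-1, [[1], [2], [1,2], [], [2]]), (-2, [[1], [0], [0,1], [], [3]]), (2, [[1], [0], [1,3], [], [0]]), (2, [[1], [0], [1,2], [], [1]]), (1, [[2], [0], [1,2], [], [3]]), (3, [[1], [2], [1,2], [], [3]]), (1, [[2], [0], [1,3], [], [0]]), (-1, [[2], [2], [1,2], [], [1]]), (1, [[2], [2], [1,2], [], [3]])]),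
    ([[], [0,2], [1], [4], [0,2]], [(1, [[2], [0], [1,2], [], [0]])]),
    ([[], [0,2], [1], [4], [0,3]], [(1, [[1], [1], [1,2], [], [3]]), (1, [[1], [0], [1,2], [], [3]]), (-1, [[1], [2], [1,2], [], [0]])]),
    ([[], [0,2], [2], [0], [0,2]], [(1, [[2], [0], [2,3], [], [0]])]),
    ([[], [0,2], [2], [0], [0,3]], [(1, [[2], [0], [0,3], [], [0]]), (-1, [[3], [2], [0,1], [], [2]]), (1, [[2], [2], [0,1], [], [0]]), (-1, [[3], [2], [0,2], [], [1]]), (1, [[2], [2], [0,2], [], [0]]), (1, [[2], [0], [1,3], [], [3]]), (1, [[2], [0], [1,3], [], [2]]), (-1, [[2], [2], [1,2], [], [1]]), (1, [[2], [2], [1,2], [], [2]]), (-1, [[2], [0], [1,3], [], [0]]), (-1, [[2], [2], [1,2], [], [0]]), (-1, [[1], [2], [0,1], [], [3]]), (1, [[1], [2], [1,2], [], [1]]), (1, [[2], [2], [1,2], [], [3]]), (-1, [[2], [0], [2,3], [], [0]])]),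
    ([[], [0,2], [2], [0], [1,2]], [(1, [[2], [0], [2,3], [], [1]])]),
    ([[], [0,2], [2], [0], [2,3]], [(1, [[2], [0], [2,3], [], [2]])]),
    ([[], [0,2], [2], [1], [0,1]], [(1, [[0], [2], [0,2], [], [1]])]),
    ([[], [0,2], [2], [1], [0,2]], [(1, [[0], [2], [0,2], [], [2]])]),
    ([[], [0,2], [2], [1], [0,3]], [(1, [[0], [2], [0,2], [], [0]])]),
    ([[], [0,2], [2], [1], [1,2]], [(1, [[2], [0], [2,3], [], [3]]), (1, [[2], [0], [2,3], [], [2]])]),
    ([[], [0,2], [2], [1], [1,3]], [(1, [[0], [1], [0,2], [], [1]]), (1, [[0], [0], [0,2], [], [1]]), (-1, [[0], [0], [2,3], [], [1]]), (1, [[3], [1], [1,2], [], [2]]), (1, [[3], [0], [1,2], [], [2]]), (-1, [[3], [2], [1,2], [], [0]]), (1, [[2], [0], [1,2], [], [0]]), (1, [[1], [1], [1,2], [], [3]]), (1, [[1], [0], [1,2], [], [3]]), (-1, [[1], [2], [1,2], [], [0]]), (2, [[0], [2], [0,2], [], [1]])]),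
    ([[], [0,2], [2], [1], [2,3]], [(1, [[0], [1], [0,2], [], [2]]), (1, [[0], [0], [0,2], [], [2]]), (-1, [[0], [0], [2,3], [], [2]]), (2, [[0], [2], [0,2], [], [2]])]),
    ([[], [0,2], [2], [2], [0,2]], [(1, [[0], [2], [0,2], [], [3]]), (1, [[0], [2], [0,2], [], [0]])]),
    ([[], [0,2], [2], [2], [0,3]], [(1, [[0], [2], [1,2], [], [0]])]),
    ([[], [0,2], [2], [2], [1,2]], [(1, [[2], [0], [1,2], [], [2]]), (1, [[3], [2], [1,2], [], [2]]), (1, [[2], [0], [1,2], [], [3]]), (-1, [[2], [2], [1,2], [], [0]]), (1, [[1], [2], [1,2], [], [3]])]),
    ([[], [0,2], [2], [2], [1,3]], [(1, [[0], [2], [1,2], [], [1]])]),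
    ([[], [0,2], [2], [2], [2,3]], [(1, [[0], [2], [1,2], [], [2]])]),
    ([[], [0,2], [2], [3], [0,2]], [(1, [[0], [0], [0,2], [], [3]]), (-1, [[0], [0], [2,3], [], [0]]), (1, [[0], [0], [1,2], [], [2]]), (1, [[0], [2], [0,2], [], [3]]), (1, [[0], [2], [1,2], [], [2]])]),
    ([[], [0,2], [2], [3], [0,3]], [(1, [[0], [2], [1,2], [], [3]])]),
    ([[], [0,2], [2], [3], [2,3]], [(1, [[2], [0], [0,2], [], [3]]), (-1, [[2], [2], [0,2], [], [0]]), (1, [[2], [0], [0,2], [], [2]]), (1, [[3], [2], [0,2], [], [2]]), (1, [[0], [2], [0,1], [], [3]]), (-1, [[1], [2], [1,2], [], [2]]), (1, [[2], [2], [1,2], [], [3]]), (-1, [[0], [2], [0,2], [], [1]]), (1, [[0], [2], [0,2], [], [2]]), (-1, [[2], [0], [2,3], [], [3]]), (-1, [[2], [0], [2,3], [], [2]]), (-1, [[0], [2], [0,2], [], [3]]), (-1, [[2], [0], [1,2], [], [2]]), (-1, [[3], [2], [1,2], [], [2]]), (-1, [[2], [0], [1,2], [], [3]]), (-1, [[1], [2], [1,2], [], [3]]), (-1, [[0], [2], [1,2], [], [2]]), (-2, [[0], [0], [0,2], [], [3]]), (2, [[0], [0], [2,3], [], [0]]), (-2, [[0], [0], [1,2], [], [2]]), (-3, [[0], [2], [1,2], [], [3]])]),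
    ([[], [0,2], [2], [4], [0,3]], [(1, [[0], [1], [1,2], [], [3]]), (1, [[0], [0], [1,2], [], [3]]), (-1, [[0], [2], [1,2], [], [0]])]),
    ([[], [0,2], [3], [0], [0,1]], [(1, [[3], [2], [1,3], [], [1]])]),
    ([[], [0,2], [3], [0], [0,2]], [(1, [[2], [2], [0,3], [], [0]])]),
    ([[], [0,2], [3], [0], [0,3]], [(1, [[2], [2], [1,3], [], [0]])]),
    ([[], [0,2], [3], [0], [1,2]], [(1, [[2], [2], [0,3], [], [1]])]),
    ([[], [0,2], [3], [0], [1,3]], [(1, [[2], [2], [1,3], [], [1]])]),
    ([[], [0,2], [3], [0], [2,3]], [(1, [[2], [2], [0,3], [], [3]])]),
    ([[], [0,2], [3], [1], [0,1]], [(1, [[3], [2], [2,3], [], [1]])]),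
    ([[], [0,2], [3], [1], [0,2]], [(1, [[3], [2], [2,3], [], [2]])]),
    ([[], [0,2], [3], [1], [0,3]], [(1, [[2], [2], [2,3], [], [0]])]),
    ([[], [0,2], [3], [1], [1,2]], [(1, [[2], [2], [0,3], [], [2]])]),
    ([[], [0,2], [3], [1], [1,3]], [(1, [[2], [2], [2,3], [], [1]])]),
    ([[], [0,2], [3], [1], [2,3]], [(1, [[2], [2], [2,3], [], [2]])]),
    ([[], [0,2], [3], [2], [0,1]], [(1, [[3], [2], [1,3], [], [0]])]),
    ([[], [0,2], [3], [2], [0,2]], [(1, [[3], [2], [2,3], [], [0]])]),
    ([[], [0,2], [3], [2], [0,3]], [(1, [[0], [2], [1,3], [], [0]])]),
    ([[], [0,2], [3], [2], [1,3]], [(1, [[1], [2], [2,3], [], [1]])]),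
    ([[], [0,2], [3], [2], [2,3]], [(1, [[0], [2], [1,3], [], [2]])]),
    ([[], [0,2], [3], [3], [0,3]], [(1, [[0], [2], [1,3], [], [3]])]),
    ([[], [0,2], [3], [3], [1,3]], [(1, [[2], [2], [1,3], [], [3]])]),
    ([[], [0,2], [3], [3], [2,3]], [(1, [[2], [2], [2,3], [], [3]])]),
    ([[], [1,2], [0], [0], [0,1]], [(1, [[4], [1], [0,1], [], [1]])]),
    ([[], [1,2], [0], [0], [0,2]], [(1, [[3], [2], [0,3], [], [0]]), (-1, [[2], [2], [0,3], [], [0]])]),
    ([[], [1,2], [0], [0], [0,3]], [(1, [[4], [2], [0,1], [], [0]])]),
    ([[], [1,2], [0], [0], [1,2]], [(1, [[3], [2], [0,3], [], [1]]), (-1, [[2], [2], [0,3], [], [1]])]),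
    ([[], [1,2], [0], [0], [1,3]], [(1, [[4], [2], [0,1], [], [1]])]),
    ([[], [1,2], [0], [0], [2,3]], [(1, [[4], [2], [0,1], [], [2]])]),
    ([[], [1,2], [0], [1], [0,1]], [(1, [[4], [1], [0,2], [], [1]])]),
    ([[], [1,2], [0], [1], [0,2]], [(1, [[4], [1], [0,2], [], [2]])]),
    ([[], [1,2], [0], [1], [0,3]], [(1, [[4], [2], [0,2], [], [0]])]),
    ([[], [1,2], [0], [1], [1,2]], [(1, [[3], [2], [0,3], [], [2]]), (-1, [[2], [2], [0,3], [], [2]])]),
    ([[], [1,2], [0], [1], [1,3]], [(1, [[4], [2], [0,2], [], [1]])]),
    ([[], [1,2], [0], [1], [2,3]], [(1, [[4], [2], [0,2], [], [2]])]),
    ([[], [1,2], [0], [2], [0,1]], [(1, [[4], [1], [0,1], [], [0]])]),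
    ([[], [1,2], [0], [2], [0,2]], [(1, [[4], [1], [0,2], [], [0]])]),
    ([[], [1,2], [0], [2], [0,3]], [(1, [[3], [1], [1,3], [], [2]]), (1, [[3], [1], [0,3], [], [0]]), (1, [[3], [1], [2,3], [], [1]]), (-1, [[4], [1], [0,1], [], [0]]), (-1, [[4], [1], [0,2], [], [0]])]),
    ([[], [1,2], [0], [2], [1,3]], [(1, [[4], [1], [0,1], [], [3]]), (-1, [[4], [2], [0,1], [], [0]])]),
    ([[], [1,2], [0], [2], [2,3]], [(1, [[4], [1], [0,2], [], [3]]), (-1, [[4], [2], [0,2], [], [0]])]),
    ([[], [1,2], [0], [3], [0,3]], [(1, [[3], [1], [0,3], [], [3]]), (-1, [[4], [0], [1,3], [], [2]]), (-1, [[4], [0], [2,3], [], [1]]), (1, [[2], [2], [0,3], [], [0]]), (-1, [[1], [2], [2,3], [], [1]]), (-1, [[0], [2], [1,3], [], [2]]), (-1, [[4], [1], [0,1], [], [3]]), (-1, [[4], [1], [0,2], [], [3]])]),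
    ([[], [1,2], [0], [3], [1,3]], [(1, [[4], [2], [0,1], [], [3]])]),
    ([[], [1,2], [0], [3], [2,3]], [(1, [[4], [2], [0,2], [], [3]])]),
    ([[], [1,2], [1], [0], [0,1]], [(1, [[1], [1], [1,3], [], [1]])]),
    ([[], [1,2], [1], [0], [0,2]], [(1, [[1], [1], [1,3], [], [2]])]),
    ([[], [1,2], [1], [0], [0,3]], [(1, [[1], [2], [1,3], [], [0]])]),
    ([[], [1,2], [1], [0], [1,3]], [(1, [[1], [2], [1,3], [], [1]])]),
    ([[], [1,2], [1], [0], [2,3]], [(1, [[1], [2], [1,3], [], [2]])]),
    ([[], [1,2], [1], [1], [0,1]], [(1, [[4], [1], [1,2], [], [1]])]),
    ([[], [1,2], [1], [1], [0,2]], [(1, [[4], [1], [1,2], [], [2]])]),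
    ([[], [1,2], [1], [1], [0,3]], [(1, [[4], [2], [1,2], [], [0]])]),
    ([[], [1,2], [1], [1], [1,2]], [(1, [[3], [2], [1,3], [], [2]]), (1, [[2], [2], [0,3], [], [0]]), (1, [[3], [2], [2,3], [], [1]])]),
    ([[], [1,2], [1], [1], [1,3]], [(1, [[4], [2], [1,2], [], [1]])]),
    ([[], [1,2], [1], [1], [2,3]], [(1, [[4], [2], [1,2], [], [2]])]),
    ([[], [1,2], [1], [2], [0,1]], [(1, [[1], [1], [1,3], [], [0]])]),
    ([[], [1,2], [1], [2], [0,2]], [(1, [[4], [1], [1,2], [], [0]])]),
    ([[], [1,2], [1], [2], [1,3]], [(1, [[1], [1], [1,3], [], [3]]), (-1, [[1], [2], [1,3], [], [0]])]),
    ([[], [1,2], [1], [2], [2,3]], [(1, [[4], [1], [1,2], [], [3]]), (-1, [[4], [2], [1,2], [], [0]])]),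
    ([[], [1,2], [1], [3], [1,3]], [(1, [[1], [2], [1,3], [], [3]])]),
    ([[], [1,2], [1], [3], [2,3]], [(1, [[4], [2], [1,2], [], [3]])]),
    ([[], [1,2], [2], [1], [0,1]], [(1, [[0], [1], [2,3], [], [1]])]),
    ([[], [1,2], [2], [1], [0,2]], [(1, [[0], [1], [2,3], [], [2]])]),
    ([[], [1,2], [2], [1], [0,3]], [(1, [[0], [2], [2,3], [], [0]])]),
    ([[], [1,2], [2], [1], [1,3]], [(1, [[0], [2], [2,3], [], [1]])]),
    ([[], [1,2], [2], [1], [2,3]], [(1, [[0], [2], [2,3], [], [2]])]),
    ([[], [1,2], [2], [2], [0,2]], [(1, [[0], [1], [2,3], [], [0]])]),
    ([[], [1,2], [2], [2], [1,3]], [(1, [[2], [1], [0,3], [], [0]]), (1, [[3], [2], [0,3], [], [0]]), (-1, [[2], [2], [0,3], [], [0]]), (1, [[4], [2], [0,1], [], [0]]), (1, [[4], [2], [0,2], [], [0]]), (1, [[3], [1], [1,3], [], [2]]), (1, [[3], [1], [2,3], [], [1]]), (1, [[4], [1], [1,2], [], [1]]), (-1, [[4], [1], [1,2], [], [2]]), (1, [[1], [1], [1,3], [], [3]]), (-1, [[1], [2], [1,3], [], [0]]), (-1, [[4], [1], [1,2], [], [3]]), (1, [[4], [2], [1,2], [], [0]])]),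
    ([[], [1,2], [2], [2], [2,3]], [(1, [[0], [1], [2,3], [], [3]]), (-1, [[0], [2], [2,3], [], [0]])]),
    ([[], [1,2], [2], [3], [2,3]], [(1, [[0], [2], [2,3], [], [3]])]),
    ([[], [1,2], [3], [0], [0,1]], [(1, [[4], [1], [1,3], [], [1]])]),
    ([[], [1,2], [3], [0], [0,2]], [(1, [[4], [2], [0,3], [], [0]])]),
    ([[], [1,2], [3], [0], [0,3]], [(1, [[4], [2], [1,3], [], [0]])]),
    ([[], [1,2], [3], [0], [1,2]], [(1, [[4], [2], [0,3], [], [1]])]),
    ([[], [1,2], [3], [0], [1,3]], [(1, [[4], [2], [1,3], [], [1]])]),
    ([[], [1,2], [3], [0], [2,3]], [(1, [[4], [2], [0,3], [], [3]])]),
    ([[], [1,2], [3], [1], [0,1]], [(1, [[4], [1], [2,3], [], [1]])]),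
    ([[], [1,2], [3], [1], [0,2]], [(1, [[4], [1], [2,3], [], [2]])]),
    ([[], [1,2], [3], [1], [0,3]], [(1, [[4], [2], [2,3], [], [0]])]),
    ([[], [1,2], [3], [1], [1,2]], [(1, [[4], [2], [0,3], [], [2]])]),
    ([[], [1,2], [3], [1], [1,3]], [(1, [[4], [2], [2,3], [], [1]])]),
    ([[], [1,2], [3], [1], [2,3]], [(1, [[4], [2], [2,3], [], [2]])]),
    ([[], [1,2], [3], [2], [0,1]], [(1, [[4], [1], [1,3], [], [0]])]),
    ([[], [1,2], [3], [2], [0,2]], [(1, [[4], [1], [2,3], [], [0]])]),
    ([[], [1,2], [3], [2], [0,3]], [(1, [[4], [1], [0,3], [], [0]]), (1, [[4], [2], [0,3], [], [0]]), (1, [[4], [2], [1,3], [], [0]]), (1, [[4], [2], [2,3], [], [0]]), (-1, [[4], [1], [1,3], [], [0]]), (-1, [[4], [1], [2,3], [], [0]])]),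
    ([[], [1,2], [3], [2], [1,3]], [(1, [[4], [1], [1,3], [], [3]]), (-1, [[4], [2], [1,3], [], [0]])]),
    ([[], [1,2], [3], [2], [2,3]], [(1, [[4], [1], [2,3], [], [3]]), (-1, [[4], [2], [2,3], [], [0]])]),
    ([[], [1,2], [3], [3], [0,3]], [(1, [[4], [1], [0,3], [], [3]]), (1, [[4], [2], [0,3], [], [3]]), (-1, [[4], [1], [1,3], [], [3]]), (-1, [[4], [1], [2,3], [], [3]])]),
    ([[], [1,2], [3], [3], [1,3]], [(1, [[4], [2], [1,3], [], [3]])]),
    ([[], [1,2], [3], [3], [2,3]], [(1, [[4], [2], [2,3], [], [3]])])]"

text \<open>The size 64 is \<open>7 * 9 + 1\<close>, just enough to exclude border rank 7.\<close>

lemma certificate4: "echelon_certificate factors4 [0..<4] certificate4 \<and> length certificate4 = 64"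
  by code_simp

text \<open>The size 253 is \<open>14 * 18 + 1\<close>, just enough to exclude border rank
  14.\<close>

lemma certificate5: "echelon_certificate factors5 [0..<5] certificate5 \<and> length certificate5 = 253"
  by code_simp

text \<open>
  Glynn's formula writes \<open>8 * perm\<close> as the sum of \<open>prod_list \<delta> * (\<Prod>j. \<Sum>i. \<delta> i * x i j)\<close> over the sign vectors
  with first entry 1.
\<close>

definition glynn_signs :: "int list list" where
  "glynn_signs = [[1, 1, 1, 1], [1, 1, 1, - 1], [1, 1, - 1, 1], [1, 1, - 1, - 1],
     [1, - 1, 1, 1], [1, - 1, 1, - 1], [1, - 1, - 1, 1], [1, - 1, - 1, - 1]]"

text \<open>The sum over the three free signs vanishes unless the indices 1, 2 and 3 each occur an
  odd number of times in \<open>I\<close>. As \<open>I\<close> has length 4, it is then a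
  permutation, and all eight terms are 1.\<close>

lemma glynn_identity:
  "list_all (\<lambda>I. (\<Sum>\<delta>\<leftarrow>glynn_signs. prod_list \<delta> * prod_list (map ((!) \<delta>) I))
     = (if distinct I then 8 else 0)) (List.n_lists 4 [0..<4])"
  by code_simp

lemma tensor_rank_perm4_le:
  assumes "CHAR('k::field) \<noteq> 2"
  shows "tensor_rank (replicate 4 4) (perm_tensor 4 :: 'k tensor) \<le> 8"
proof -
  have "(2 :: 'k) \<noteq> 0" using of_int_pivot_nonzero[OF assms, of 2] by simp
  then have "(2 :: 'k) ^ 3 \<noteq> 0" by (rule power_not_zero)
  then have nz: "(8 :: 'k) \<noteq> 0" by simp
  have len: "length glynn_signs = 8" by (simp add: glynn_signs_def)
  define w :: "int list \<Rightarrow> 'k vec" where "w \<delta> = vec 4 (\<lambda>j. of_int (\<delta> ! j))" for \<delta>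
  \<comment> \<open>The scalar of each term in Glynn's formula, including the division by 8, is
    placed on the first of its four vectors.\<close>
  define v where "v i = (let \<delta> = glynn_signs ! i in
    (of_int (prod_list \<delta>) / 8) \<cdot>\<^sub>v w \<delta> # replicate 3 (w \<delta>))" for i
  have dim: "map dim_vec (v i) = replicate 4 4" for i
    by (simp add: v_def w_def Let_def numeral_eq_Suc)
  have "(perm_tensor 4 :: 'k tensor) = (\<lambda>I. \<Sum>i<8. pure_tensor (v i) I)"
  proof
    fix I :: "nat list"
    show "(perm_tensor 4 I :: 'k) = (\<Sum>i<8. pure_tensor (v i) I)"
    proof (cases "I \<in> multi_indices (replicate 4 4)")
      case True
      then obtain a b c d where I: "I = [a, b, c, d]" "a < 4" "b < 4" "c < 4" "d < 4"
        by (auto simp: numeral_eq_Suc multi_indices_Cons multi_indices_Nil)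
      have pure: "pure_tensor (v i) I = of_int (prod_list (glynn_signs ! i)
          * prod_list (map ((!) (glynn_signs ! i)) I)) / 8" for i
        using I(2-5)
        by (simp add: v_def w_def Let_def I(1) numeral_3_eq_3 pure_tensor_Cons pure_tensor_Nil)
      have "I \<in> set (List.n_lists 4 [0..<4])"
        using I by (simp add: set_n_lists)
      then have "(\<Sum>\<delta>\<leftarrow>glynn_signs. prod_list \<delta> * prod_list (map ((!) \<delta>) I))
          = (if distinct I then 8 else 0)"
        using glynn_identity unfolding list_all_iff by blast
      moreover have "(\<Sum>\<delta>\<leftarrow>glynn_signs. prod_list \<delta> * prod_list (map ((!) \<delta>) I))
          = (\<Sum>i<8. prod_list (glynn_signs ! i) * prod_list (map ((!) (glynn_signs ! i)) I))"
        unfolding sum_list_sum_nth length_map len atLeast0LessThan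
        by (intro sum.cong refl) (simp add: len)
      ultimately have sum: "(\<Sum>i<8. prod_list (glynn_signs ! i)
          * prod_list (map ((!) (glynn_signs ! i)) I)) = (if distinct I then 8 else 0)"
        by simp
      have "(\<Sum>i<8. pure_tensor (v i) I) = of_int (\<Sum>i<8. prod_list (glynn_signs ! i)
          * prod_list (map ((!) (glynn_signs ! i)) I)) / 8"
        by (simp only: pure of_int_sum sum_divide_distrib)
      also have "\<dots> = (if distinct I then 1 else 0)"
        unfolding sum using nz by simp
      also have "\<dots> = perm_tensor 4 I"
        unfolding perm_tensor_entry using I by auto
      finally show ?thesis by simp
    next
      case False
      then have "pure_tensor (v i) I = 0" for i by (simp add: pure_tensor_outside dim)
      moreover have "perm_tensor 4 I = (0 :: 'k)"
        using False perm_tensor_in_tensor_space[of 4] unfolding tensor_space_def by blast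
      ultimately show ?thesis by simp
    qed
  qed
  then show ?thesis
    unfolding tensor_rank_def by (intro Least_le exI[of _ v] conjI allI impI dim)
qed

section \<open>The numerical bounds\<close>

lemma border_rank_perm4_ge:
  assumes "CHAR('k::field) \<noteq> 2"
  shows "8 \<le> border_rank (replicate 4 4) (perm_tensor 4 :: 'k tensor)"
proof -
  let ?fss = "zip factors4 [1, 3, 3, 1]"
  have "factor_low_rank TYPE('k) 4 (wedge 4 [0, 1, 2, 3]) 3"
    "factor_low_rank TYPE('k) 4 (contract 4 [0, 1, 2, 3]) 3"
    using factor_low_rank_wedge[of "[0, 1, 2, 3]" 4 4]
      factor_low_rank_contract[of "[0, 1, 2, 3]" 4 4] by simp_all
  moreover have "replicate 4 (4 :: nat) = [4, 4, 4, 4]" by (simp add: numeral_eq_Suc)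
  ultimately have "list_all2 (\<lambda>n (f, s). factor_low_rank TYPE('k) n f s) (replicate 4 4) ?fss"
    by (simp add: factors4_def factor_low_rank_row_index factor_low_rank_column_index del: One_nat_def)
  \<comment> \<open>The factor bounds multiply to \<open>1 * 3 * 3 * 1 = 9\<close>, and
    \<open>7 * 9 = 63 < 64\<close>.\<close>
  from border_rank_perm_greater[OF assms this, of certificate4 7] certificate4
  show ?thesis by (simp add: factors4_def)
qed

lemma border_rank_perm5_ge:
  assumes "CHAR('k::field) \<noteq> 2"
  shows "15 \<le> border_rank (replicate 5 5) (perm_tensor 5 :: 'k tensor)"
proof -
  let ?fss = "zip factors5 [1, 2, 3, 1, 3]"
  have "factor_low_rank TYPE('k) 5 (wedge 3 [2, 2, 1, 2, 0]) 2"
    "factor_low_rank TYPE('k) 5 (contract 4 [2, 1, 0, 0, 3]) 3"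
    "factor_low_rank TYPE('k) 5 (wedge 4 [1, 2, 0, 3, 0]) 3"
    using factor_low_rank_wedge[of "[2, 2, 1, 2, 0]" 5 3]
      factor_low_rank_contract[of "[2, 1, 0, 0, 3]" 5 4]
      factor_low_rank_wedge[of "[1, 2, 0, 3, 0]" 5 4] by simp_all
  moreover have "replicate 5 (5 :: nat) = [5, 5, 5, 5, 5]" by (simp add: numeral_eq_Suc)
  ultimately have "list_all2 (\<lambda>n (f, s). factor_low_rank TYPE('k) n f s) (replicate 5 5) ?fss"
    by (simp add: factors5_def factor_low_rank_row_index factor_low_rank_column_index del: One_nat_def)
  \<comment> \<open>The factor bounds multiply to \<open>1 * 2 * 3 * 1 * 3 = 18\<close>, and
    \<open>14 * 18 = 252 < 253\<close>.\<close>
  from border_rank_perm_greater[OF assms this, of certificate5 14] certificate5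
  show ?thesis by (simp add: factors5_def)
qed

theorem theorem5p7:
  assumes "CHAR('k::field) \<noteq> 2"
  shows "tensor_rank (replicate 4 4) (perm_tensor 4 :: 'k tensor) = 8
    \<and> border_rank (replicate 4 4) (perm_tensor 4 :: 'k tensor) = 8
    \<and> border_rank (replicate 5 5) (perm_tensor 5 :: 'k tensor) \<ge> 15"
proof -
  have "border_rank (replicate 4 4) (perm_tensor 4 :: 'k tensor)
      \<le> tensor_rank (replicate 4 4) (perm_tensor 4 :: 'k tensor)"
    by (rule border_rank_le_tensor_rank[OF perm_tensor_in_tensor_space])
  \<comment> \<open>For order 4, border rank and tensor rank are squeezed between 8 and 8.\<close>
  with border_rank_perm4_ge[OF assms] border_rank_perm5_ge[OF assms] tensor_rank_perm4_le[OF assms]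
  show ?thesis by linarith
qed

end
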